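(* For $1\le j\le L-1$, let $\rho_j^0\in L^1(\mathbb{R}^+)$ be such that for all $t\in[0,\tau_j]$ $$e^{-t\mu_j}\int_t^{\tau_j}\rho_j^0(s-t)\,ds+\frac{1}{\mu_j}\left(1-e^{-\mu_j t}\right)\sum_{l=j}^{L}\mu_l N_l<N_j .$$ Assume that for all $j=1,\dots,L-1$ the parameters are such that $$\overline{A_j}:=\frac{\mu_jN_je^{-\mu_j\tau_j}-(1-e^{-\mu_j\tau_j})\,C^{no}_{j+1}}{\mu_j}>0 .$$ Then, for every $j=1,\dots,L-1$, the equation $$\partial_t\rho_j+\partial_s\rho_j+\mu_j\rho_j+\frac{C^{no}_{j+1}}{A_j(t)}\,\mathbb{I}_{s\ge\tau_j}\,\rho_j=0,\quad t\ge0,\ s\ge 0,\qquad \rho_j(t,s=0)=\sum_{l=j}^{L}\mu_lN_l,$$ with initial condition $\rho_j(0,\cdot)=\rho_j^0$, is well posed. Moreover $A_j(t)>0$ for all $t\ge0$, and $A_j(t)=\overline{A_j}$ for all $t\ge\tau_j$.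
   Context: $L\ge2$ is an integer (number of hierarchical job levels). For $1\le j\le L$, the parameters $N_j>0$ (size of job class $j$), $\mu_j>0$ (turnover rate) and $\tau_j\ge0$ (minimal waiting time before promotion) are given constants. $\rho_j(t,s)$ is the density of workers in job $j$ at time $t$ with seniority $s$ in that job. Notation: $\mathbb{I}$ is the indicator function, $$A_j(t)=\int_{\tau_j}^{+\infty}\rho_j(t,s)\,ds,\qquad C^{no}_j:=\sum_{l=j}^{L}\mu_lN_l .$$ The equation is nonlinear since $A_j(t)$ depends on $\rho_j$. Standing assumptions on the initial data: $\rho_j^0(s)>0$ and $\int_0^{+\infty}\rho_j^0(s)\,ds=N_j$. "Well posed" means that there is a unique global-in-time solution $\rho_j\in C([0,\infty);L^1(\mathbb{R}^+))$ (in the weak sense, equivalently given by integration along characteristics) with $A_j(t)>0$, so that the equation makes sense. *)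

theory Defs
  imports "HOL-Analysis.Analysis"
begin

definition C_no :: "nat \<Rightarrow> (nat \<Rightarrow> real) \<Rightarrow> (nat \<Rightarrow> real) \<Rightarrow> nat \<Rightarrow> real" where
  "C_no L \<mu> N j = (\<Sum>l=j..L. \<mu> l * N l)"

definition eligible_mass :: "real \<Rightarrow> (real \<Rightarrow> real) \<Rightarrow> real" where
  "eligible_mass \<tau> f = (LINT s:{\<tau>..}|lborel. f s)"

definition A_bar :: "nat \<Rightarrow> (nat \<Rightarrow> real) \<Rightarrow> (nat \<Rightarrow> real) \<Rightarrow> (nat \<Rightarrow> real) \<Rightarrow> nat \<Rightarrow> real" where
  "A_bar L N \<mu> \<tau> j =
    (\<mu> j * N j * exp (- \<mu> j * \<tau> j) - (1 - exp (- \<mu> j * \<tau> j)) * C_no L \<mu> N (j + 1)) / \<mu> j"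

text \<open>The space \<open>C([0,\<infinity>); L\<^sup>1(\<real>\<^sup>+))\<close>.  Elements of \<open>L\<^sup>1\<close> are given by Borel representatives, so
  \<open>\<rho> t\<close> matters only up to null sets; joint measurability of \<open>\<rho>\<close> is not required.\<close>

definition continuous_into_L1 :: "(real \<Rightarrow> real \<Rightarrow> real) \<Rightarrow> bool" where
  "continuous_into_L1 \<rho> \<longleftrightarrow>
    (\<forall>t\<ge>0. set_integrable lborel {0..} (\<rho> t)) \<and>
    (\<forall>t\<^sub>0\<ge>0. ((\<lambda>t. LINT s:{0..}|lborel. \<bar>\<rho> t s - \<rho> t\<^sub>0 s\<bar>) \<longlongrightarrow> 0) (at t\<^sub>0 within {0..}))"

text \<open>Test functions \<open>\<phi> \<in> C\<^sup>1\<^sub>c([0,\<infinity>) \<times> [0,\<infinity>))\<close>, with partial derivatives \<open>\<phi>\<^sub>t\<close> and \<open>\<phi>\<^sub>s\<close>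
  (one-sided on the boundary).  They need not vanish for \<open>t = 0\<close> or \<open>s = 0\<close>.\<close>

definition test_function ::
  "(real \<Rightarrow> real \<Rightarrow> real) \<Rightarrow> (real \<Rightarrow> real \<Rightarrow> real) \<Rightarrow> (real \<Rightarrow> real \<Rightarrow> real) \<Rightarrow> bool" where
  "test_function \<phi> \<phi>\<^sub>t \<phi>\<^sub>s \<longleftrightarrow>
    (\<forall>t\<ge>0. \<forall>s\<ge>0.
       ((\<lambda>u. \<phi> u s) has_real_derivative \<phi>\<^sub>t t s) (at t within {0..}) \<and>
       ((\<lambda>u. \<phi> t u) has_real_derivative \<phi>\<^sub>s t s) (at s within {0..})) \<and>
    continuous_on ({0..} \<times> {0..}) (\<lambda>(t, s). \<phi>\<^sub>t t s) \<and>
    continuous_on ({0..} \<times> {0..}) (\<lambda>(t, s). \<phi>\<^sub>s t s) \<and>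
    (\<exists>R. \<forall>t\<ge>0. \<forall>s\<ge>0. t > R \<or> s > R \<longrightarrow> \<phi> t s = 0)"

text \<open>Weak solutions of
  \<open>\<partial>\<^sub>t\<rho> + \<partial>\<^sub>s\<rho> + \<mu> \<rho> + (c / A(t)) 1\<^bsub>s \<ge> \<tau>\<^esub> \<rho> = 0\<close>, \<open>\<rho>(t,0) = b\<close>, \<open>\<rho>(0,\<cdot>) = \<rho>\<^sub>0\<close>,
  where \<open>A(t)\<close> is the mass of \<open>\<rho>(t,\<cdot>)\<close> on \<open>[\<tau>,\<infinity>)\<close>, assumed positive.  The identity is obtained by
  multiplying with a test function and integrating by parts, which produces the two boundary terms
  carrying the initial and the inflow condition.  As \<open>t \<mapsto> \<rho> t\<close> is continuous into \<open>L\<^sup>1\<close> and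
  \<open>A\<close> is continuous and positive, the inner integral is continuous and compactly supported in \<open>t\<close>,
  so all integrals converge.\<close>

definition weak_solution ::
  "real \<Rightarrow> real \<Rightarrow> real \<Rightarrow> real \<Rightarrow> (real \<Rightarrow> real) \<Rightarrow> (real \<Rightarrow> real \<Rightarrow> real) \<Rightarrow> bool" where
  "weak_solution \<mu> \<tau> c b \<rho>\<^sub>0 \<rho> \<longleftrightarrow>
    continuous_into_L1 \<rho> \<and>
    (\<forall>t\<ge>0. eligible_mass \<tau> (\<rho> t) > 0) \<and>
    (\<forall>\<phi> \<phi>\<^sub>t \<phi>\<^sub>s. test_function \<phi> \<phi>\<^sub>t \<phi>\<^sub>s \<longrightarrow>
       (LINT t:{0..}|lborel. LINT s:{0..}|lborel.
          \<rho> t s * (\<phi>\<^sub>t t s + \<phi>\<^sub>s t s - \<mu> * \<phi> t s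
            - c / eligible_mass \<tau> (\<rho> t) * indicator {\<tau>..} s * \<phi> t s))
       + (LINT s:{0..}|lborel. \<rho>\<^sub>0 s * \<phi> 0 s)
       + (LINT t:{0..}|lborel. b * \<phi> t 0) = 0)"

definition well_posed :: "real \<Rightarrow> real \<Rightarrow> real \<Rightarrow> real \<Rightarrow> (real \<Rightarrow> real) \<Rightarrow> bool" where
  "well_posed \<mu> \<tau> c b \<rho>\<^sub>0 \<longleftrightarrow>
    (\<exists>\<rho>. weak_solution \<mu> \<tau> c b \<rho>\<^sub>0 \<rho> \<and>
      (\<forall>\<rho>'. weak_solution \<mu> \<tau> c b \<rho>\<^sub>0 \<rho>' \<longrightarrow>
        (\<forall>t\<ge>0. AE s in lborel. s \<ge> 0 \<longrightarrow> \<rho>' t s = \<rho> t s)))"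

end

theory Submission
  imports Defs
begin

text \<open>Testing the equation against functions of the characteristic coordinate \<open>s - t\<close> yields an
  integral balance for the mass to the left of each characteristic. Below seniority \<open>\<tau>\<close> the
  equation is linear with constant rate, so the mass on \<open>[0, \<tau>]\<close> is explicit; the promotion term
  always removes exactly \<open>c\<close> per unit of time, so the total mass stays \<open>N\<close>. Hence the eligible
  mass \<open>A\<close> of every solution is a known positive function and the equation becomes linear with
  the known rate \<open>c / A\<close>. Uniqueness follows from the balance by Gronwall's lemma, uniformly over
  all characteristics. For existence, integrate along characteristics with the rate \<open>c / A\<close>; the
  balance shows that the eligible mass of the result is indeed \<open>A\<close>.\<close>

section \<open>Weighted masses of curves in \<open>L\<^sup>1\<close>\<close>

text \<open>The obstacle is the regularity of an arbitrary weak solution: it is a curve in L1, not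
  assumed jointly measurable, so it can neither be evaluated along a characteristic nor be
  integrated by Fubini's theorem. Everything about it is therefore read off from scalar functions of
  time. A weight \<psi>(s - t) is invariant under transport, so testing with \<theta>(t) \<psi>(s -
  t) leaves an equation in t alone in which no derivative of \<psi> survives, and \<psi> may be
  replaced by the indicator of a half line. The mass below \<tau> is explicit because the
  characteristic that reaches \<tau> at time t has not met the promotion term before. The assumption
  on the initial data says that this mass stays below N up to time \<tau>, that is, A > 0. For
  existence a gap remains: the rate c / A removes exactly c only if the eligible mass is already
  known to be A. It is closed by a homogeneous linear equation for the deviation of the total mass
  from N.\<close>

lemma set_integrable_mult_bounded:
  fixes f w :: "real \<Rightarrow> real"
  assumes f: "set_integrable lborel A f"
    and w: "w \<in> borel_measurable borel" "\<And>s. \<bar>w s\<bar> \<le> K"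
  shows "set_integrable lborel A (\<lambda>s. f s * w s)"
proof -
  have "integrable lborel (\<lambda>s. w s * (indicator A s *\<^sub>R f s))"
  proof (rule Bochner_Integration.integrable_bound[of _ "\<lambda>s. K * (indicator A s *\<^sub>R f s)"])
    show "integrable lborel (\<lambda>s. K * (indicator A s *\<^sub>R f s))"
      using f unfolding set_integrable_def by (intro integrable_mult_right)
    show "(\<lambda>s. w s * (indicator A s *\<^sub>R f s)) \<in> borel_measurable lborel"
      using w f by (auto simp: set_integrable_def intro!: borel_measurable_times)
    have "\<bar>w s\<bar> \<le> \<bar>K\<bar>" for s
      using w(2)[of s] by linarith
    then show "AE s in lborel. norm (w s * (indicator A s *\<^sub>R f s)) \<le> norm (K * (indicator A s *\<^sub>R f s))"
      by (auto simp: abs_mult intro!: mult_right_mono)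
  qed
  then show ?thesis
    by (simp add: set_integrable_def mult.assoc mult.commute mult.left_commute)
qed

lemma abs_set_integral_mult_le:
  fixes f w :: "real \<Rightarrow> real"
  assumes f: "set_integrable lborel A f"
    and w: "w \<in> borel_measurable borel" "\<And>s. \<bar>w s\<bar> \<le> K"
  shows "\<bar>LINT s:A|lborel. f s * w s\<bar> \<le> K * (LINT s:A|lborel. \<bar>f s\<bar>)"
proof -
  have i: "set_integrable lborel A (\<lambda>s. f s * w s)"
    by (rule set_integrable_mult_bounded[OF assms])
  have "\<bar>LINT s:A|lborel. f s * w s\<bar> \<le> (LINT s:A|lborel. \<bar>f s * w s\<bar>)"
    using integral_abs_bound[of lborel "\<lambda>s. indicator A s *\<^sub>R (f s * w s)"]
    by (simp add: set_lebesgue_integral_def abs_mult)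
  also have "\<dots> \<le> (LINT s:A|lborel. K * \<bar>f s\<bar>)"
    using i f w(2)
    by (intro set_integral_mono set_integrable_mult_right set_integrable_abs)
       (auto simp: abs_mult mult.commute[of K] intro!: mult_left_mono)
  finally show ?thesis by simp
qed

text \<open>Dominated convergence with majorant \<open>K * \<bar>f s\<bar>\<close>. Convergence of
  the weights is asked only almost everywhere, so they may be indicators of intervals with a moving
  end point.\<close>

lemma set_integral_bounded_convergence:
  fixes f :: "real \<Rightarrow> real" and w :: "nat \<Rightarrow> real \<Rightarrow> real"
  assumes f: "set_integrable lborel A f"
    and w: "\<And>n. w n \<in> borel_measurable borel" "\<And>n s. \<bar>w n s\<bar> \<le> K"
    and v: "v \<in> borel_measurable borel"
    and lim: "AE s in lborel. (\<lambda>n. w n s) \<longlonglongrightarrow> v s"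
  shows "(\<lambda>n. LINT s:A|lborel. f s * w n s) \<longlonglongrightarrow> (LINT s:A|lborel. f s * v s)"
  unfolding set_lebesgue_integral_def
proof (rule integral_dominated_convergence[of _ _ _ "\<lambda>s. K * \<bar>indicator A s *\<^sub>R f s\<bar>"])
  have m: "(\<lambda>s. indicator A s *\<^sub>R f s) \<in> borel_measurable lborel"
    using f by (auto simp: set_integrable_def)
  show "(\<lambda>s. indicator A s *\<^sub>R (f s * v s)) \<in> borel_measurable lborel"
    using borel_measurable_times[OF m, of v] v by (simp add: mult.assoc)
  show "(\<lambda>s. indicator A s *\<^sub>R (f s * w n s)) \<in> borel_measurable lborel" for n
    using borel_measurable_times[OF m, of "w n"] w by (simp add: mult.assoc)
  show "integrable lborel (\<lambda>s. K * \<bar>indicator A s *\<^sub>R f s\<bar>)"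
    using f unfolding set_integrable_def by (intro integrable_mult_right integrable_abs)
  show "AE s in lborel. (\<lambda>n. indicator A s *\<^sub>R (f s * w n s)) \<longlonglongrightarrow> indicator A s *\<^sub>R (f s * v s)"
    using lim by eventually_elim (intro tendsto_intros)
  show "AE s in lborel. norm (indicator A s *\<^sub>R (f s * w n s)) \<le> K * \<bar>indicator A s *\<^sub>R f s\<bar>" for n
    using w(2)[of n] by (auto simp: abs_mult mult.commute[of K] intro!: AE_I2 mult_left_mono split: split_indicator)
qed

lemma continuous_into_L1D:
  assumes "continuous_into_L1 \<rho>" "t \<ge> 0"
  shows "set_integrable lborel {0..} (\<rho> t)"
  using assms unfolding continuous_into_L1_def by blast

lemma continuous_into_L1_sequentially:
  assumes \<rho>: "continuous_into_L1 \<rho>" and a: "a \<ge> 0" and u: "\<And>n. u n \<ge> 0" and lim: "u \<longlonglongrightarrow> a"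
  shows "(\<lambda>n. LINT s:{0..}|lborel. \<bar>\<rho> (u n) s - \<rho> a s\<bar>) \<longlonglongrightarrow> 0"
proof -
  have "((\<lambda>t. LINT s:{0..}|lborel. \<bar>\<rho> t s - \<rho> a s\<bar>) \<longlongrightarrow> 0) (at a within {0..})"
    using \<rho> a unfolding continuous_into_L1_def by auto
  \<comment> \<open>The punctured filter ignores indices with \<open>u n = a\<close>. As the
    distance at \<open>a\<close> itself is 0, the limit is continuity at \<open>a\<close>, which
    covers such sequences.\<close>
  then have "continuous (at a within {0..}) (\<lambda>t. LINT s:{0..}|lborel. \<bar>\<rho> t s - \<rho> a s\<bar>)"
    by (simp add: continuous_within)
  then show ?thesis
    using u lim by (auto simp: continuous_within_sequentially o_def)
qed

text \<open>Change the density and the weight separately: the first change costs at most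
  \<open>K\<close> times the L1 distance, the second is bounded convergence against the fixed
  density \<open>\<rho> a\<close>. Continuity of the weight in time for almost every
  \<open>s\<close> suffices, which admits indicators of half lines that move with
  \<open>t\<close>.\<close>

lemma continuous_on_weighted_mass:
  assumes \<rho>: "continuous_into_L1 \<rho>"
    and w: "\<And>t. t \<ge> 0 \<Longrightarrow> w t \<in> borel_measurable borel" "\<And>t s. \<bar>w t s\<bar> \<le> K"
    and cont: "\<And>t. t \<ge> 0 \<Longrightarrow> AE s in lborel. continuous (at t within {0..}) (\<lambda>u. w u s)"
  shows "continuous_on {0..} (\<lambda>t. LINT s:{0..}|lborel. \<rho> t s * w t s)"
proof (rule continuous_on_sequentiallyI)
  fix u and a :: real assume u: "\<forall>n. u n \<in> {0..}" and a: "a \<in> {0..}" and lim: "u \<longlonglongrightarrow> a"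
  have ia: "set_integrable lborel {0..} (\<rho> a)" and iu: "\<And>n. set_integrable lborel {0..} (\<rho> (u n))"
    using continuous_into_L1D[OF \<rho>] u a by auto
  have d: "set_integrable lborel {0..} (\<lambda>s. \<rho> (u n) s - \<rho> a s)" for n
    using ia iu by auto
  have 1: "(\<lambda>n. LINT s:{0..}|lborel. \<rho> a s * w (u n) s) \<longlonglongrightarrow> (LINT s:{0..}|lborel. \<rho> a s * w a s)"
  proof (rule set_integral_bounded_convergence[OF ia])
    show "AE s in lborel. (\<lambda>n. w (u n) s) \<longlonglongrightarrow> w a s"
      using cont[of a] a u lim
      by (auto simp: continuous_within_sequentially o_def elim!: eventually_mono)
  qed (use w u a in auto)
  have 2: "(\<lambda>n. LINT s:{0..}|lborel. \<bar>\<rho> (u n) s - \<rho> a s\<bar>) \<longlonglongrightarrow> 0"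
    using continuous_into_L1_sequentially[OF \<rho>] u a lim by auto
  have 3: "(\<lambda>n. LINT s:{0..}|lborel. (\<rho> (u n) s - \<rho> a s) * w (u n) s) \<longlonglongrightarrow> 0"
  proof (rule Lim_null_comparison)
    show "\<forall>\<^sub>F n in sequentially. norm (LINT s:{0..}|lborel. (\<rho> (u n) s - \<rho> a s) * w (u n) s)
        \<le> K * (LINT s:{0..}|lborel. \<bar>\<rho> (u n) s - \<rho> a s\<bar>)"
      using abs_set_integral_mult_le[OF d] w u by simp
    show "(\<lambda>n. K * (LINT s:{0..}|lborel. \<bar>\<rho> (u n) s - \<rho> a s\<bar>)) \<longlonglongrightarrow> 0"
      using tendsto_mult_right_zero[OF 2] by simp
  qed
  have "(LINT s:{0..}|lborel. \<rho> (u n) s * w (u n) s) =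
      (LINT s:{0..}|lborel. (\<rho> (u n) s - \<rho> a s) * w (u n) s) + (LINT s:{0..}|lborel. \<rho> a s * w (u n) s)" for n
  proof (subst set_integral_add(2)[symmetric])
    show "set_integrable lborel {0..} (\<lambda>s. (\<rho> (u n) s - \<rho> a s) * w (u n) s)"
      using u w by (intro set_integrable_mult_bounded[OF d]) auto
    show "set_integrable lborel {0..} (\<lambda>s. \<rho> a s * w (u n) s)"
      using u w by (intro set_integrable_mult_bounded[OF ia]) auto
  qed (simp add: algebra_simps)
  then show "(\<lambda>n. LINT s:{0..}|lborel. \<rho> (u n) s * w (u n) s) \<longlonglongrightarrow> (LINT s:{0..}|lborel. \<rho> a s * w a s)"
    using tendsto_add[OF 3 1] by simp
qed

text \<open>The reverse triangle inequality. This norm is the majorant in time for dominated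
  convergence and the a priori bound for Gronwall's lemma.\<close>

lemma continuous_on_L1_norm:
  assumes \<rho>: "continuous_into_L1 \<rho>"
  shows "continuous_on {0..} (\<lambda>t. LINT s:{0..}|lborel. \<bar>\<rho> t s\<bar>)"
proof (rule continuous_on_sequentiallyI)
  fix u and a :: real assume u: "\<forall>n. u n \<in> {0..}" and a: "a \<in> {0..}" and lim: "u \<longlonglongrightarrow> a"
  have ia: "set_integrable lborel {0..} (\<rho> a)" and iu: "\<And>n. set_integrable lborel {0..} (\<rho> (u n))"
    using continuous_into_L1D[OF \<rho>] u a by auto
  have 2: "(\<lambda>n. LINT s:{0..}|lborel. \<bar>\<rho> (u n) s - \<rho> a s\<bar>) \<longlonglongrightarrow> 0"
    using continuous_into_L1_sequentially[OF \<rho>] u a lim by auto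
  have "\<bar>(LINT s:{0..}|lborel. \<bar>\<rho> (u n) s\<bar>) - (LINT s:{0..}|lborel. \<bar>\<rho> a s\<bar>)\<bar>
      \<le> (LINT s:{0..}|lborel. \<bar>\<rho> (u n) s - \<rho> a s\<bar>)" for n
  proof -
    have i: "set_integrable lborel {0..} (\<lambda>s. \<bar>\<rho> (u n) s\<bar>)" "set_integrable lborel {0..} (\<lambda>s. \<bar>\<rho> a s\<bar>)"
      "set_integrable lborel {0..} (\<lambda>s. \<bar>\<rho> (u n) s - \<rho> a s\<bar>)"
      using ia iu by (auto intro!: set_integrable_abs)
    have "(LINT s:{0..}|lborel. \<bar>\<rho> (u n) s\<bar>) \<le> (LINT s:{0..}|lborel. \<bar>\<rho> (u n) s - \<rho> a s\<bar> + \<bar>\<rho> a s\<bar>)"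
      "(LINT s:{0..}|lborel. \<bar>\<rho> a s\<bar>) \<le> (LINT s:{0..}|lborel. \<bar>\<rho> (u n) s - \<rho> a s\<bar> + \<bar>\<rho> (u n) s\<bar>)"
      using i by (auto simp del: set_integral_add intro!: set_integral_mono set_integral_add(1))
    then show ?thesis
      using i by (simp add: set_integral_add)
  qed
  then have "(\<lambda>n. (LINT s:{0..}|lborel. \<bar>\<rho> (u n) s\<bar>) - (LINT s:{0..}|lborel. \<bar>\<rho> a s\<bar>)) \<longlonglongrightarrow> 0"
    by (intro Lim_null_comparison[OF _ 2]) simp
  then show "(\<lambda>n. LINT s:{0..}|lborel. \<bar>\<rho> (u n) s\<bar>) \<longlonglongrightarrow> (LINT s:{0..}|lborel. \<bar>\<rho> a s\<bar>)"
    by (simp add: LIM_zero_iff)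
qed

section \<open>Functions of time: antiderivatives and weak derivatives\<close>

lemma antiderivative_atLeast:
  fixes q :: "real \<Rightarrow> real"
  assumes "continuous_on {0..} q"
  obtains R where "R 0 = 0" "\<And>t. t \<ge> 0 \<Longrightarrow> (R has_real_derivative q t) (at t within {0..})"
proof -
  \<comment> \<open>Freezing \<open>q\<close> at its value at 0 for negative times gives a
    continuous function on the whole line; restricting its antiderivative yields the one-sided
    derivative at 0.\<close>
  have "continuous_on UNIV (\<lambda>t. q (max 0 t))"
    by (rule continuous_on_compose2[OF assms]) (auto intro!: continuous_intros)
  then have "isCont (\<lambda>t. q (max 0 t)) t" for t
    by (simp add: continuous_on_eq_continuous_at)
  then obtain F where F: "\<And>t. (F has_vector_derivative q (max 0 t)) (at t)"
    using einterval_antiderivative[of "-\<infinity>" "\<infinity>" "\<lambda>t. q (max 0 t)"] by auto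
  show thesis
  proof (rule that[of "\<lambda>t. F t - F 0"])
    fix t :: real assume "t \<ge> 0"
    then have "(F has_real_derivative q t) (at t)"
      using F[of t] by (simp add: has_real_derivative_iff_has_vector_derivative)
    from DERIV_diff[OF this DERIV_const] show "((\<lambda>t. F t - F 0) has_real_derivative q t) (at t within {0..})"
      by (auto intro: has_field_derivative_at_within)
  qed simp
qed

lemma set_integral_derivative:
  fixes q R :: "real \<Rightarrow> real"
  assumes "\<And>t. t \<ge> 0 \<Longrightarrow> (R has_real_derivative q t) (at t within {0..})"
    and "continuous_on {0..} q" and "0 \<le> x" "x \<le> y"
  shows "(LINT t:{x..y}|lborel. q t) = R y - R x"
  unfolding set_lebesgue_integral_def
proof (rule integral_FTC_atLeastAtMost)
  show "(R has_vector_derivative q t) (at t within {x..y})" if "x \<le> t" "t \<le> y" for t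
    using assms(1)[of t] assms(3) that
    by (auto simp: has_real_derivative_iff_has_vector_derivative intro: has_vector_derivative_within_subset)
  show "continuous_on {x..y} q"
    using assms(2) by (rule continuous_on_subset) (use assms in auto)
qed fact

lemma set_integrable_continuous_Icc:
  fixes q :: "real \<Rightarrow> real"
  assumes "continuous_on {0..} q" "0 \<le> x"
  shows "set_integrable lborel {x..y} q"
  by (rule borel_integrable_atLeastAtMost') (use assms in \<open>auto intro: continuous_on_subset\<close>)

lemma set_integral_atLeast_eq_Icc:
  fixes f :: "real \<Rightarrow> real"
  assumes "\<And>t. t > S \<Longrightarrow> f t = 0"
  shows "(LINT t:{x..}|lborel. f t) = (LINT t:{x..S}|lborel. f t)"
  unfolding set_lebesgue_integral_def
  by (rule Bochner_Integration.integral_cong) (use assms in \<open>auto simp: not_le split: split_indicator\<close>)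

text \<open>The test function \<open>\<theta>\<close> is chosen so that its derivative is the defect \<open>m - R - m0\<close> times a
  nonnegative cutoff, \<open>R\<close> being the antiderivative of \<open>q\<close>.\<close>

lemma weak_derivative_imp_integral_eq:
  fixes m q :: "real \<Rightarrow> real"
  assumes m: "continuous_on {0..} m" and q: "continuous_on {0..} q"
    and weak: "\<And>\<theta> \<theta>' S. (\<And>t. t \<ge> 0 \<Longrightarrow> (\<theta> has_real_derivative \<theta>' t) (at t within {0..})) \<Longrightarrow>
      continuous_on {0..} \<theta>' \<Longrightarrow> (\<And>t. t > S \<Longrightarrow> \<theta> t = 0 \<and> \<theta>' t = 0) \<Longrightarrow>
      (LINT t:{0..}|lborel. \<theta>' t * m t + \<theta> t * q t) + \<theta> 0 * m0 = 0"
    and T: "T \<ge> 0"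
  shows "m T = m0 + (LINT t:{0..T}|lborel. q t)"
proof -
  obtain R where R0: "R 0 = 0" and R: "\<And>t. t \<ge> 0 \<Longrightarrow> (R has_real_derivative q t) (at t within {0..})"
    using antiderivative_atLeast[OF q] by blast
  have cR: "continuous_on {0..} R"
    using R by (intro DERIV_continuous_on) auto
  \<comment> \<open>Beyond \<open>T\<close>, so that the cutoff \<open>max 0 (S - t)\<close> is
    still positive at \<open>T\<close>.\<close>
  define S where "S = T + 1"
  define D where "D = (\<lambda>t. m t - R t - m0)"
  define g where "g = (\<lambda>t. D t * max 0 (S - t))"
  have cg: "continuous_on {0..} g" and cD: "continuous_on {0..} D"
    unfolding g_def D_def using m cR by (auto intro!: continuous_intros)
  obtain \<Theta> where \<Theta>: "\<And>t. t \<ge> 0 \<Longrightarrow> (\<Theta> has_real_derivative g t) (at t within {0..})"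
    using antiderivative_atLeast[OF cg] by blast
  have S: "S > 0" using T by (simp add: S_def)
  have gS: "g t = 0" if "t \<ge> S" for t using that by (simp add: g_def)
  have \<Theta>S: "\<Theta> t = \<Theta> S" if "t > S" for t
  proof -
    have "(LINT t:{S..t}|lborel. g t) = (LINT t:{S..t}|lborel. 0)"
      by (rule set_lebesgue_integral_cong) (auto simp: gS)
    moreover have "(LINT t:{S..t}|lborel. g t) = \<Theta> t - \<Theta> S"
      by (rule set_integral_derivative[OF \<Theta> cg]) (use S that in auto)
    ultimately show ?thesis by simp
  qed
  define \<theta> where "\<theta> = (\<lambda>t. \<Theta> t - \<Theta> S)"
  have \<theta>: "(\<theta> has_real_derivative g t) (at t within {0..})" if "t \<ge> 0" for t
    unfolding \<theta>_def using \<Theta>[OF that] by (auto intro!: derivative_eq_intros)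
  have c\<theta>: "continuous_on {0..} \<theta>"
    using \<theta> by (intro DERIV_continuous_on) auto
  have "(LINT t:{0..}|lborel. g t * m t + \<theta> t * q t) + \<theta> 0 * m0 = 0"
    by (rule weak[OF \<theta> cg, of S]) (auto simp: gS \<Theta>S \<theta>_def)
  then have "(LINT t:{0..S}|lborel. g t * m t + \<theta> t * q t) + \<theta> 0 * m0 = 0"
    by (subst (asm) set_integral_atLeast_eq_Icc[of S]) (auto simp: gS \<Theta>S \<theta>_def)
  \<comment> \<open>Write \<open>m\<close> as \<open>D + (R + m0)\<close>. The terms without
    \<open>D\<close> are the derivative of \<open>\<theta> * (R + m0)\<close> and integrate to minus
    \<open>\<theta> 0 * m0\<close>, cancelling the initial term. What remains is the integral of
    \<open>D\<close> squared times the cutoff.\<close>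
  moreover have "(LINT t:{0..S}|lborel. g t * m t + \<theta> t * q t) =
      (LINT t:{0..S}|lborel. D t * g t + (g t * (R t + m0) + \<theta> t * q t))"
    by (simp add: D_def algebra_simps)
  moreover have "\<dots> = (LINT t:{0..S}|lborel. D t * g t) + (LINT t:{0..S}|lborel. g t * (R t + m0) + \<theta> t * q t)"
    using cD cg cR c\<theta> q by (intro set_integral_add(2) set_integrable_continuous_Icc) (auto intro!: continuous_intros)
  moreover have "(LINT t:{0..S}|lborel. g t * (R t + m0) + \<theta> t * q t) = \<theta> S * (R S + m0) - \<theta> 0 * (R 0 + m0)"
    using S \<theta> R cD cg cR c\<theta> q
    by (intro set_integral_derivative[where R="\<lambda>t. \<theta> t * (R t + m0)"])
       (auto intro!: derivative_eq_intros continuous_intros)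
  moreover have "\<theta> S = 0" by (simp add: \<theta>_def)
  ultimately have "(LINT t:{0..S}|lborel. D t * g t) = 0"
    using R0 by simp
  then have "integral {0..S} (\<lambda>t. D t * g t) = 0"
    using cD cg by (subst (asm) set_borel_integral_eq_integral(2)) (auto intro!: set_integrable_continuous_Icc continuous_intros)
  moreover have "continuous_on {0..S} (\<lambda>t. D t * g t)"
    by (rule continuous_on_subset[of "{0..}"]) (use cD cg in \<open>auto intro!: continuous_intros\<close>)
  moreover have "D t * g t \<ge> 0" for t
    unfolding g_def mult.assoc[symmetric] by (intro mult_nonneg_nonneg zero_le_square) auto
  ultimately have "\<forall>t\<in>{0..S}. D t * g t = 0"
    using S by (subst (asm) integral_eq_0_iff) auto
  then have "D T * g T = 0"
    using T by (auto simp: S_def)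
  then have "D T = 0" by (simp add: g_def S_def)
  moreover have "(LINT t:{0..T}|lborel. q t) = R T - R 0"
    by (rule set_integral_derivative[OF R q]) (use T in auto)
  ultimately show ?thesis using R0 by (simp add: D_def)
qed

section \<open>Smooth cutoffs and test functions of product form\<close>

lemma DERIV_max_0_square: "((\<lambda>x::real. (max 0 x)\<^sup>2) has_real_derivative 2 * max 0 x) (at x)"
proof (cases x "0::real" rule: linorder_cases)
  case less
  have "((\<lambda>x::real. 0) has_real_derivative 2 * max 0 x) (at x)" using less by simp
  then show ?thesis
    by (rule has_field_derivative_transform_within_open[of _ _ _ "{..<0}"]) (use less in auto)
next
  case equal
  have "((\<lambda>h::real. (max 0 h)\<^sup>2 / h) \<longlongrightarrow> 0) (at 0)"
  proof (rule Lim_null_comparison)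
    show "\<forall>\<^sub>F h::real in at 0. norm ((max 0 h)\<^sup>2 / h) \<le> \<bar>h\<bar>"
      by (auto simp: max_def power2_eq_square)
  qed (auto intro!: tendsto_eq_intros)
  then show ?thesis using equal by (simp add: DERIV_def)
next
  case greater
  have "((\<lambda>x::real. x\<^sup>2) has_real_derivative 2 * max 0 x) (at x)"
    using greater by (auto intro!: derivative_eq_intros)
  then show ?thesis
    by (rule has_field_derivative_transform_within_open[of _ _ _ "{0<..}"]) (use greater in auto)
qed

text \<open>With \<open>q\<close> the squared positive part, which is C1, the function q(1 - q(k(x -
  y))) is 1 up to \<open>y\<close> and falls to 0 within a layer of width 1/k. The layer lies to the
  right of \<open>y\<close>, so the limit is the closed half line at every point, \<open>y\<close>
  included.\<close>

lemma smooth_cutoff: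
  fixes y :: real
  obtains \<psi> \<psi>' :: "nat \<Rightarrow> real \<Rightarrow> real"
  where "\<And>n x. (\<psi> n has_real_derivative \<psi>' n x) (at x)" "\<And>n. continuous_on UNIV (\<psi>' n)"
    "\<And>n x. \<bar>\<psi> n x\<bar> \<le> 1" "\<And>n x. x > y + 1 \<Longrightarrow> \<psi> n x = 0"
    "\<And>x. (\<lambda>n. \<psi> n x) \<longlonglongrightarrow> indicator {..y} x"
proof -
  define q where "q = (\<lambda>x::real. (max 0 x)\<^sup>2)"
  \<comment> \<open>At least 1 for every \<open>n\<close>, so that all layers end before
    \<open>y + 1\<close>.\<close>
  define k where "k = (\<lambda>n::nat. real n + 1)"
  define \<psi> where "\<psi> = (\<lambda>n x. q (1 - q (k n * (x - y))))"
  define \<psi>' where "\<psi>' = (\<lambda>n x. 2 * max 0 (1 - q (k n * (x - y))) * (- (2 * max 0 (k n * (x - y)) * k n)))"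
  have q: "(q has_real_derivative 2 * max 0 x) (at x)" for x
    unfolding q_def by (rule DERIV_max_0_square)
  have one: "\<psi> n x = 1" if "x \<le> y" for n x
  proof -
    have "k n * (x - y) \<le> 0" using that by (simp add: k_def mult_le_0_iff)
    then show ?thesis by (simp add: \<psi>_def q_def)
  qed
  have zero: "\<psi> n x = 0" if "k n * (x - y) \<ge> 1" for n x
  proof -
    have "q (k n * (x - y)) \<ge> 1"
      using that one_le_power[OF that, of 2] by (simp add: q_def)
    then show ?thesis unfolding \<psi>_def by (subst q_def) simp
  qed
  show thesis
  proof
    fix n :: nat and x :: real
    show "(\<psi> n has_real_derivative \<psi>' n x) (at x)"
      unfolding \<psi>_def \<psi>'_def
      by (rule derivative_eq_intros DERIV_chain2[OF q] refl)+ auto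
    show "continuous_on UNIV (\<psi>' n)"
      unfolding \<psi>'_def q_def by (intro continuous_intros)
    have "0 \<le> q u" for u by (simp add: q_def)
    then have "\<bar>max 0 (1 - q u)\<bar> \<le> 1" for u by (simp add: max_def)
    then show "\<bar>\<psi> n x\<bar> \<le> 1"
      unfolding \<psi>_def by (subst q_def) (simp add: power2_eq_square mult_le_one abs_mult)
    show "\<psi> n x = 0" if "x > y + 1"
    proof (rule zero)
      have "1 * 1 \<le> k n * (x - y)" using that by (intro mult_mono) (auto simp: k_def)
      then show "1 \<le> k n * (x - y)" by simp
    qed
    show "(\<lambda>n. \<psi> n x) \<longlonglongrightarrow> indicator {..y} x"
    proof (cases "x \<le> y")
      case True then show ?thesis by (simp add: one)
    next
      case False
      then have d: "x - y > 0" by simp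
      obtain n0 :: nat where n0: "1 / (x - y) < real n0" using reals_Archimedean2 by blast
      have "\<psi> n x = 0" if "n \<ge> n0" for n
      proof (rule zero)
        have "1 / (x - y) \<le> k n" using n0 that by (simp add: k_def)
        then show "1 \<le> k n * (x - y)" using d by (simp add: field_simps)
      qed
      then have "\<forall>\<^sub>F n in sequentially. \<psi> n x = indicator {..y} x"
        using False by (auto simp: eventually_sequentially)
      then show ?thesis by (rule tendsto_eventually)
    qed
  qed
qed

text \<open>The two derivatives add up to \<open>\<theta>' t * \<psi> (s - t)\<close>: the
  derivative of \<open>\<psi>\<close> cancels because \<open>s - t\<close> is constant along
  characteristics. It suffices that \<open>\<psi>\<close> vanishes far to the right, since
  \<open>\<theta>\<close> bounds \<open>t\<close> and \<open>s \<ge> 0\<close>.\<close>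

lemma test_function_product:
  assumes \<theta>: "\<And>t. t \<ge> 0 \<Longrightarrow> (\<theta> has_real_derivative \<theta>' t) (at t within {0..})"
    and \<theta>': "continuous_on {0..} \<theta>'" and \<theta>0: "\<And>t. t > S \<Longrightarrow> \<theta> t = 0"
    and \<psi>: "\<And>x. (\<psi> has_real_derivative \<psi>' x) (at x)"
    and \<psi>': "continuous_on UNIV \<psi>'" and \<psi>0: "\<And>x. x > Y \<Longrightarrow> \<psi> x = 0"
  shows "test_function (\<lambda>t s. \<theta> t * \<psi> (s - t)) (\<lambda>t s. \<theta>' t * \<psi> (s - t) - \<theta> t * \<psi>' (s - t))
    (\<lambda>t s. \<theta> t * \<psi>' (s - t))"
  unfolding test_function_def
proof (intro conjI allI impI)
  have c\<theta>: "continuous_on {0..} \<theta>"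
    using \<theta> by (intro DERIV_continuous_on) auto
  have c\<psi>: "continuous_on UNIV \<psi>"
    using \<psi> by (intro DERIV_continuous_on) auto
  note [continuous_intros] = continuous_on_compose2[OF c\<theta>] continuous_on_compose2[OF c\<psi>]
    continuous_on_compose2[OF \<theta>'] continuous_on_compose2[OF \<psi>']
  show "continuous_on ({0..} \<times> {0..}) (\<lambda>(t, s). \<theta>' t * \<psi> (s - t) - \<theta> t * \<psi>' (s - t))"
    unfolding case_prod_beta by (intro continuous_intros) auto
  show "continuous_on ({0..} \<times> {0..}) (\<lambda>(t, s). \<theta> t * \<psi>' (s - t))"
    unfolding case_prod_beta by (intro continuous_intros) auto
  fix t s :: real assume "t \<ge> 0" "s \<ge> 0"
  show "((\<lambda>u. \<theta> u * \<psi> (s - u)) has_real_derivative \<theta>' t * \<psi> (s - t) - \<theta> t * \<psi>' (s - t)) (at t within {0..})"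
    by (rule derivative_eq_intros \<theta> DERIV_chain2[OF \<psi>] refl \<open>t \<ge> 0\<close>)+ auto
  show "((\<lambda>u. \<theta> t * \<psi> (u - t)) has_real_derivative \<theta> t * \<psi>' (s - t)) (at s within {0..})"
    by (rule derivative_eq_intros \<theta> DERIV_chain2[OF \<psi>] refl \<open>t \<ge> 0\<close>)+ auto
next
  show "\<exists>R. \<forall>t\<ge>0. \<forall>s\<ge>0. t > R \<or> s > R \<longrightarrow> \<theta> t * \<psi> (s - t) = 0"
  \<comment> \<open>For \<open>t \<le> S\<close>, \<open>s > S + Y\<close> forces
    \<open>s - t > Y\<close>. The maximum covers negative \<open>Y\<close>, where
    \<open>t > S + Y\<close> alone would not give \<open>t > S\<close>.\<close>
  proof (intro exI[of _ "max S (S + Y)"] allI impI)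
    fix t s :: real assume "t \<ge> 0" "s \<ge> 0" "t > max S (S + Y) \<or> s > max S (S + Y)"
    then have "t > S \<or> s - t > Y" by auto
    then show "\<theta> t * \<psi> (s - t) = 0" using \<theta>0 \<psi>0 by auto
  qed
qed

section \<open>Mass balance along characteristics\<close>

text \<open>The promotion rate is frozen to a prescribed \<open>a\<close>, so that one set of
  balance laws serves both the nonlinear equation, with the rate read off from the solution, and the
  linear construction.\<close>

definition linear_weak_solution ::
  "real \<Rightarrow> real \<Rightarrow> (real \<Rightarrow> real) \<Rightarrow> real \<Rightarrow> (real \<Rightarrow> real) \<Rightarrow> (real \<Rightarrow> real \<Rightarrow> real) \<Rightarrow> bool" where
  "linear_weak_solution \<mu> \<tau> a b \<rho>\<^sub>0 \<rho> \<longleftrightarrow>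
    continuous_into_L1 \<rho> \<and>
    (\<forall>\<phi> \<phi>\<^sub>t \<phi>\<^sub>s. test_function \<phi> \<phi>\<^sub>t \<phi>\<^sub>s \<longrightarrow>
       (LINT t:{0..}|lborel. LINT s:{0..}|lborel.
          \<rho> t s * (\<phi>\<^sub>t t s + \<phi>\<^sub>s t s - \<mu> * \<phi> t s - a t * indicator {\<tau>..} s * \<phi> t s))
       + (LINT s:{0..}|lborel. \<rho>\<^sub>0 s * \<phi> 0 s)
       + (LINT t:{0..}|lborel. b * \<phi> t 0) = 0)"

lemma weak_solution_iff_linear:
  "weak_solution \<mu> \<tau> c b \<rho>\<^sub>0 \<rho> \<longleftrightarrow>
    linear_weak_solution \<mu> \<tau> (\<lambda>t. c / eligible_mass \<tau> (\<rho> t)) b \<rho>\<^sub>0 \<rho> \<and>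
    (\<forall>t\<ge>0. eligible_mass \<tau> (\<rho> t) > 0)"
  unfolding weak_solution_def linear_weak_solution_def by blast

text \<open>The weight acts on the label \<open>s - t\<close> of a characteristic. For
  \<open>\<psi> = indicator {..y}\<close> this is the mass on seniorities up to
  \<open>y + t\<close>, the part to the left of the characteristic with label
  \<open>y\<close>.\<close>

definition weighted_mass :: "(real \<Rightarrow> real \<Rightarrow> real) \<Rightarrow> (real \<Rightarrow> real) \<Rightarrow> real \<Rightarrow> real" where
  "weighted_mass \<rho> \<psi> t = (LINT s:{0..}|lborel. \<rho> t s * \<psi> (s - t))"

definition eligible_weighted_mass :: "real \<Rightarrow> (real \<Rightarrow> real \<Rightarrow> real) \<Rightarrow> (real \<Rightarrow> real) \<Rightarrow> real \<Rightarrow> real" where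
  "eligible_weighted_mass \<tau> \<rho> \<psi> t = (LINT s:{0..}|lborel. \<rho> t s * (indicator {\<tau>..} s * \<psi> (s - t)))"

text \<open>The time-integrated mass balance; \<open>\<psi> (- t)\<close> is the weight of those
  entering at time \<open>t\<close> with seniority 0. Integrability is included because a
  non-integrable function has integral 0 by convention, which would make the identity
  meaningless.\<close>

definition balanced ::
  "real \<Rightarrow> real \<Rightarrow> (real \<Rightarrow> real) \<Rightarrow> real \<Rightarrow> (real \<Rightarrow> real) \<Rightarrow> (real \<Rightarrow> real \<Rightarrow> real) \<Rightarrow> (real \<Rightarrow> real) \<Rightarrow> bool" where
  "balanced \<mu> \<tau> a b \<rho>\<^sub>0 \<rho> \<psi> \<longleftrightarrow> (\<forall>T\<ge>0.
    set_integrable lborel {0..T}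
      (\<lambda>t. b * \<psi> (- t) - \<mu> * weighted_mass \<rho> \<psi> t - a t * eligible_weighted_mass \<tau> \<rho> \<psi> t) \<and>
    weighted_mass \<rho> \<psi> T = (LINT s:{0..}|lborel. \<rho>\<^sub>0 s * \<psi> s) +
      (LINT t:{0..T}|lborel. b * \<psi> (- t) - \<mu> * weighted_mass \<rho> \<psi> t - a t * eligible_weighted_mass \<tau> \<rho> \<psi> t))"

lemma continuous_on_weighted_mass_smooth:
  assumes \<rho>: "continuous_into_L1 \<rho>" and \<psi>: "continuous_on UNIV \<psi>" "\<And>x. \<bar>\<psi> x\<bar> \<le> 1"
  shows "continuous_on {0..} (weighted_mass \<rho> \<psi>)"
    and "continuous_on {0..} (eligible_weighted_mass \<tau> \<rho> \<psi>)"
proof -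
  have m: "\<psi> \<in> borel_measurable borel"
    using \<psi>(1) by (rule borel_measurable_continuous_onI)
  have c: "continuous (at t within {0..}) (\<lambda>u. \<psi> (s - u))" for t s
  proof (rule continuous_at_imp_continuous_within)
    have "continuous_on UNIV (\<lambda>u. \<psi> (s - u))"
      by (rule continuous_on_compose2[OF \<psi>(1)]) (auto intro!: continuous_intros)
    then show "isCont (\<lambda>u. \<psi> (s - u)) t"
      by (simp add: continuous_on_eq_continuous_at)
  qed
  show "continuous_on {0..} (weighted_mass \<rho> \<psi>)"
    unfolding weighted_mass_def using m c
    by (intro continuous_on_weighted_mass[OF \<rho>, where K=1] \<psi>(2)) auto
  show "continuous_on {0..} (eligible_weighted_mass \<tau> \<rho> \<psi>)"
    unfolding eligible_weighted_mass_def using m c \<psi>(2)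
    by (intro continuous_on_weighted_mass[OF \<rho>, where K=1])
       (auto simp: indicator_def)
qed

text \<open>Testing with \<open>\<theta> t * \<psi> (s - t)\<close> and evaluating the integral over
  \<open>s\<close> for each fixed \<open>t\<close> leaves exactly the hypothesis of
  \<open>weak_derivative_imp_integral_eq\<close>. The order of integration is never
  exchanged.\<close>

lemma balanced_smooth:
  assumes sol: "linear_weak_solution \<mu> \<tau> a b \<rho>\<^sub>0 \<rho>" and a: "continuous_on {0..} a"
    and \<psi>: "\<And>x. (\<psi> has_real_derivative \<psi>' x) (at x)" "continuous_on UNIV \<psi>'"
    "\<And>x. \<bar>\<psi> x\<bar> \<le> 1" "\<And>x. x > Y \<Longrightarrow> \<psi> x = 0"
  shows "balanced \<mu> \<tau> a b \<rho>\<^sub>0 \<rho> \<psi>"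
  unfolding balanced_def
proof (intro allI impI conjI)
  fix T :: real assume T: "T \<ge> 0"
  have \<rho>: "continuous_into_L1 \<rho>" using sol by (simp add: linear_weak_solution_def)
  have c\<psi>: "continuous_on UNIV \<psi>" using \<psi>(1) by (intro DERIV_continuous_on) auto
  then have m\<psi>: "\<psi> \<in> borel_measurable borel" by (rule borel_measurable_continuous_onI)
  note cm = continuous_on_weighted_mass_smooth[OF \<rho> c\<psi> \<psi>(3)]
  let ?m = "weighted_mass \<rho> \<psi>" and ?p = "eligible_weighted_mass \<tau> \<rho> \<psi>"
  let ?q = "\<lambda>t. b * \<psi> (- t) - \<mu> * ?m t - a t * ?p t"
  have c': "continuous_on {0..} (\<lambda>t. \<psi> (- t))"
    by (rule continuous_on_compose2[OF c\<psi>]) (auto intro!: continuous_intros)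
  have cq: "continuous_on {0..} ?q"
    using a cm c' by (intro continuous_intros)
  show "set_integrable lborel {0..T} ?q"
    by (rule set_integrable_continuous_Icc[OF cq]) simp
  show "?m T = (LINT s:{0..}|lborel. \<rho>\<^sub>0 s * \<psi> s) + (LINT t:{0..T}|lborel. ?q t)"
  proof (rule weak_derivative_imp_integral_eq[OF cm(1) cq _ T])
    fix \<theta> \<theta>' S
    assume \<theta>: "\<And>t. t \<ge> 0 \<Longrightarrow> (\<theta> has_real_derivative \<theta>' t) (at t within {0..})"
      and \<theta>': "continuous_on {0..} \<theta>'" and S: "\<And>t::real. t > S \<Longrightarrow> \<theta> t = 0 \<and> \<theta>' t = 0"
    have c\<theta>: "continuous_on {0..} \<theta>" using \<theta> by (intro DERIV_continuous_on) auto
    have tf: "test_function (\<lambda>t s. \<theta> t * \<psi> (s - t)) (\<lambda>t s. \<theta>' t * \<psi> (s - t) - \<theta> t * \<psi>' (s - t))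
        (\<lambda>t s. \<theta> t * \<psi>' (s - t))"
      by (rule test_function_product[OF \<theta> \<theta>' _ \<psi>(1,2,4), of S]) (use S in auto)
    have inner: "(LINT s:{0..}|lborel. \<rho> t s * (\<theta>' t * \<psi> (s - t) - \<theta> t * \<psi>' (s - t) + \<theta> t * \<psi>' (s - t)
        - \<mu> * (\<theta> t * \<psi> (s - t)) - a t * indicator {\<tau>..} s * (\<theta> t * \<psi> (s - t))))
        = \<theta>' t * ?m t - \<theta> t * (\<mu> * ?m t + a t * ?p t)" if t: "t \<ge> 0" for t
    proof -
      have i1: "set_integrable lborel {0..} (\<lambda>s. \<rho> t s * \<psi> (s - t))"
        by (rule set_integrable_mult_bounded[OF continuous_into_L1D[OF \<rho> t], where K=1]) (use m\<psi> \<psi>(3) in auto)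
      have i2: "set_integrable lborel {0..} (\<lambda>s. \<rho> t s * (indicator {\<tau>..} s * \<psi> (s - t)))"
        by (rule set_integrable_mult_bounded[OF continuous_into_L1D[OF \<rho> t], where K=1])
           (use m\<psi> \<psi>(3) in \<open>auto simp: indicator_def\<close>)
      have "(LINT s:{0..}|lborel. \<rho> t s * (\<theta>' t * \<psi> (s - t) - \<theta> t * \<psi>' (s - t) + \<theta> t * \<psi>' (s - t)
        - \<mu> * (\<theta> t * \<psi> (s - t)) - a t * indicator {\<tau>..} s * (\<theta> t * \<psi> (s - t))))
        = (LINT s:{0..}|lborel. (\<theta>' t - \<theta> t * \<mu>) * (\<rho> t s * \<psi> (s - t))
            - (\<theta> t * a t) * (\<rho> t s * (indicator {\<tau>..} s * \<psi> (s - t))))"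
        by (simp add: algebra_simps)
      also have "\<dots> = (\<theta>' t - \<theta> t * \<mu>) * ?m t - (\<theta> t * a t) * ?p t"
        using i1 i2 by (simp add: set_integral_diff weighted_mass_def eligible_weighted_mass_def)
      finally show ?thesis by (simp add: algebra_simps)
    qed
    have "(LINT t:{0..}|lborel. \<theta>' t * ?m t - \<theta> t * (\<mu> * ?m t + a t * ?p t))
        + \<theta> 0 * (LINT s:{0..}|lborel. \<rho>\<^sub>0 s * \<psi> s) + (LINT t:{0..}|lborel. b * (\<theta> t * \<psi> (- t))) = 0"
    proof -
      have "(LINT t:{0..}|lborel. LINT s:{0..}|lborel. \<rho> t s * (\<theta>' t * \<psi> (s - t) - \<theta> t * \<psi>' (s - t) + \<theta> t * \<psi>' (s - t)
        - \<mu> * (\<theta> t * \<psi> (s - t)) - a t * indicator {\<tau>..} s * (\<theta> t * \<psi> (s - t))))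
        = (LINT t:{0..}|lborel. \<theta>' t * ?m t - \<theta> t * (\<mu> * ?m t + a t * ?p t))"
        using inner by (intro set_lebesgue_integral_cong allI impI) (simp_all only: atLeast_iff sets_lborel closed_atLeast borel_closed)
      moreover have "(LINT s:{0..}|lborel. \<rho>\<^sub>0 s * (\<theta> 0 * \<psi> (s - 0))) = \<theta> 0 * (LINT s:{0..}|lborel. \<rho>\<^sub>0 s * \<psi> s)"
        by (simp add: mult.left_commute flip: set_integral_mult_right)
      moreover note sol[unfolded linear_weak_solution_def, THEN conjunct2, rule_format, OF tf]
      ultimately show ?thesis by simp
    qed
    \<comment> \<open>On \<open>{0..S}\<close> the continuous integrands are integrable, so the
      separate integrals may be added.\<close>
    moreover have "(LINT t:{0..}|lborel. \<theta>' t * ?m t - \<theta> t * (\<mu> * ?m t + a t * ?p t))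
        = (LINT t:{0..S}|lborel. \<theta>' t * ?m t - \<theta> t * (\<mu> * ?m t + a t * ?p t))"
      "(LINT t:{0..}|lborel. b * (\<theta> t * \<psi> (- t))) = (LINT t:{0..S}|lborel. b * (\<theta> t * \<psi> (- t)))"
      "(LINT t:{0..}|lborel. \<theta>' t * ?m t + \<theta> t * ?q t) = (LINT t:{0..S}|lborel. \<theta>' t * ?m t + \<theta> t * ?q t)"
      using S by (intro set_integral_atLeast_eq_Icc; simp)+
    moreover have "(LINT t:{0..S}|lborel. \<theta>' t * ?m t - \<theta> t * (\<mu> * ?m t + a t * ?p t))
        + (LINT t:{0..S}|lborel. b * (\<theta> t * \<psi> (- t))) = (LINT t:{0..S}|lborel. \<theta>' t * ?m t + \<theta> t * ?q t)"
    proof (subst set_integral_add(2)[symmetric])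
      show "set_integrable lborel {0..S} (\<lambda>t. \<theta>' t * ?m t - \<theta> t * (\<mu> * ?m t + a t * ?p t))"
        using \<theta>' c\<theta> cm a by (intro set_integrable_continuous_Icc continuous_intros) auto
      show "set_integrable lborel {0..S} (\<lambda>t. b * (\<theta> t * \<psi> (- t)))"
        using c\<theta> c' by (intro set_integrable_continuous_Icc continuous_intros) auto
    qed (simp add: algebra_simps)
    ultimately show "(LINT t:{0..}|lborel. \<theta>' t * ?m t + \<theta> t * ?q t) + \<theta> 0 * (LINT s:{0..}|lborel. \<rho>\<^sub>0 s * \<psi> s) = 0"
      by linarith
  qed
qed

lemma weighted_mass_bound:
  assumes \<rho>: "continuous_into_L1 \<rho>" and t: "t \<ge> 0"
    and \<psi>: "\<psi> \<in> borel_measurable borel" "\<And>x. \<bar>\<psi> x\<bar> \<le> 1"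
  shows "\<bar>weighted_mass \<rho> \<psi> t\<bar> \<le> (LINT s:{0..}|lborel. \<bar>\<rho> t s\<bar>)"
    and "\<bar>eligible_weighted_mass \<tau> \<rho> \<psi> t\<bar> \<le> (LINT s:{0..}|lborel. \<bar>\<rho> t s\<bar>)"
  unfolding weighted_mass_def eligible_weighted_mass_def
  using abs_set_integral_mult_le[OF continuous_into_L1D[OF \<rho> t], of "\<lambda>s. \<psi> (s - t)" 1]
    abs_set_integral_mult_le[OF continuous_into_L1D[OF \<rho> t], of "\<lambda>s. indicator {\<tau>..} s * \<psi> (s - t)" 1] \<psi>
  by (auto simp: indicator_def)

text \<open>Dominated convergence twice: in \<open>s\<close> for fixed \<open>t\<close> against the
  density, and in \<open>t\<close> against \<open>?w\<close>, which bounds inflow, turnover and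
  promotion through the L1 norm of \<open>\<rho> t\<close>. The second application also yields
  integrability of the limit.\<close>

lemma balanced_limit:
  assumes \<rho>: "continuous_into_L1 \<rho>" and a: "continuous_on {0..} a"
    and \<rho>0: "set_integrable lborel {0..} \<rho>\<^sub>0"
    and bal: "\<And>n. balanced \<mu> \<tau> a b \<rho>\<^sub>0 \<rho> (\<psi> n)"
    and \<psi>: "\<And>n. \<psi> n \<in> borel_measurable borel" "\<And>n x. \<bar>\<psi> n x\<bar> \<le> 1"
    and lim: "\<And>x. (\<lambda>n. \<psi> n x) \<longlonglongrightarrow> f x"
  shows "balanced \<mu> \<tau> a b \<rho>\<^sub>0 \<rho> f"
proof -
  have mf: "f \<in> borel_measurable borel"
    by (rule borel_measurable_LIMSEQ_real[OF lim]) (use \<psi> in auto)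
  have lm: "(\<lambda>n. weighted_mass \<rho> (\<psi> n) t) \<longlonglongrightarrow> weighted_mass \<rho> f t" if "t \<ge> 0" for t
    unfolding weighted_mass_def
    by (rule set_integral_bounded_convergence[OF continuous_into_L1D[OF \<rho> that], where K=1])
       (use \<psi> mf lim in auto)
  have lp: "(\<lambda>n. eligible_weighted_mass \<tau> \<rho> (\<psi> n) t) \<longlonglongrightarrow> eligible_weighted_mass \<tau> \<rho> f t" if "t \<ge> 0" for t
    unfolding eligible_weighted_mass_def
    by (rule set_integral_bounded_convergence[OF continuous_into_L1D[OF \<rho> that], where K=1])
       (use \<psi> mf lim in \<open>auto simp: indicator_def\<close>)
  have l0: "(\<lambda>n. LINT s:{0..}|lborel. \<rho>\<^sub>0 s * \<psi> n s) \<longlonglongrightarrow> (LINT s:{0..}|lborel. \<rho>\<^sub>0 s * f s)"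
    by (rule set_integral_bounded_convergence[OF \<rho>0, where K=1]) (use \<psi> mf lim in auto)
  let ?q = "\<lambda>\<psi> t. b * \<psi> (- t) - \<mu> * weighted_mass \<rho> \<psi> t - a t * eligible_weighted_mass \<tau> \<rho> \<psi> t"
  let ?w = "\<lambda>t. \<bar>b\<bar> + (\<bar>\<mu>\<bar> + \<bar>a t\<bar>) * (LINT s:{0..}|lborel. \<bar>\<rho> t s\<bar>)"
  show ?thesis
    unfolding balanced_def
  proof (intro allI impI)
    fix T :: real assume T: "T \<ge> 0"
    have iq: "integrable lborel (\<lambda>t. indicator {0..T} t *\<^sub>R ?q (\<psi> n) t)" for n
      using bal[of n] T unfolding balanced_def set_integrable_def by blast
    have conv: "(\<lambda>n. indicator {0..T} t *\<^sub>R ?q (\<psi> n) t) \<longlonglongrightarrow> indicator {0..T} t *\<^sub>R ?q f t" for t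
      by (cases "t \<in> {0..T}") (auto intro!: tendsto_intros lim lm lp)
    have mq: "(\<lambda>t. indicator {0..T} t *\<^sub>R ?q f t) \<in> borel_measurable lborel"
      by (rule borel_measurable_LIMSEQ_real[OF conv]) (use iq in auto)
    have iw: "integrable lborel (\<lambda>t. indicator {0..T} t *\<^sub>R ?w t)"
      unfolding set_integrable_def[symmetric]
      using a continuous_on_L1_norm[OF \<rho>] by (intro set_integrable_continuous_Icc continuous_intros) auto
    have bd: "norm (indicator {0..T} t *\<^sub>R ?q (\<psi> n) t) \<le> indicator {0..T} t *\<^sub>R ?w t" for n t
    proof (cases "t \<in> {0..T}")
      case True
      then have t: "t \<ge> 0" by simp
      have "\<bar>?q (\<psi> n) t\<bar> \<le> \<bar>b * \<psi> n (- t)\<bar> + \<bar>\<mu> * weighted_mass \<rho> (\<psi> n) t\<bar> + \<bar>a t * eligible_weighted_mass \<tau> \<rho> (\<psi> n) t\<bar>"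
        by linarith
      also have "\<dots> \<le> \<bar>b\<bar> * 1 + \<bar>\<mu>\<bar> * (LINT s:{0..}|lborel. \<bar>\<rho> t s\<bar>) + \<bar>a t\<bar> * (LINT s:{0..}|lborel. \<bar>\<rho> t s\<bar>)"
        unfolding abs_mult using weighted_mass_bound[OF \<rho> t \<psi>(1)[of n] \<psi>(2)] \<psi>(2)
        by (intro add_mono mult_left_mono) auto
      finally show ?thesis using True by (simp add: algebra_simps)
    qed simp
    have "integrable lborel (\<lambda>t. indicator {0..T} t *\<^sub>R ?q f t)"
      by (rule integrable_dominated_convergence[OF mq _ iw, where s="\<lambda>n t. indicator {0..T} t *\<^sub>R ?q (\<psi> n) t"]) (use iq conv bd in auto)
    moreover have "(\<lambda>n. LINT t:{0..T}|lborel. ?q (\<psi> n) t) \<longlonglongrightarrow> (LINT t:{0..T}|lborel. ?q f t)"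
      unfolding set_lebesgue_integral_def
      by (rule integral_dominated_convergence[OF mq _ iw]) (use iq conv bd in auto)
    moreover have "weighted_mass \<rho> (\<psi> n) T = (LINT s:{0..}|lborel. \<rho>\<^sub>0 s * \<psi> n s) + (LINT t:{0..T}|lborel. ?q (\<psi> n) t)" for n
      using bal[of n] T unfolding balanced_def by blast
    ultimately show "set_integrable lborel {0..T} (?q f) \<and>
        weighted_mass \<rho> f T = (LINT s:{0..}|lborel. \<rho>\<^sub>0 s * f s) + (LINT t:{0..T}|lborel. ?q f t)"
      using LIMSEQ_unique[OF lm[OF T]] tendsto_add[OF l0] unfolding set_integrable_def by simp
  qed
qed

lemma balanced_atMost:
  assumes sol: "linear_weak_solution \<mu> \<tau> a b \<rho>\<^sub>0 \<rho>" and a: "continuous_on {0..} a"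
    and \<rho>0: "set_integrable lborel {0..} \<rho>\<^sub>0"
  shows "balanced \<mu> \<tau> a b \<rho>\<^sub>0 \<rho> (indicator {..y})"
proof -
  have \<rho>: "continuous_into_L1 \<rho>" using sol by (simp add: linear_weak_solution_def)
  obtain \<psi> \<psi>' :: "nat \<Rightarrow> real \<Rightarrow> real"
    where \<psi>: "\<And>n x. (\<psi> n has_real_derivative \<psi>' n x) (at x)" "\<And>n. continuous_on UNIV (\<psi>' n)"
    "\<And>n x. \<bar>\<psi> n x\<bar> \<le> 1" "\<And>n x. x > y + 1 \<Longrightarrow> \<psi> n x = 0"
    "\<And>x. (\<lambda>n. \<psi> n x) \<longlonglongrightarrow> indicator {..y} x"
    using smooth_cutoff[of y] by blast
  show ?thesis
  proof (rule balanced_limit[OF \<rho> a \<rho>0 _ _ \<psi>(3,5)])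
    show "balanced \<mu> \<tau> a b \<rho>\<^sub>0 \<rho> (\<psi> n)" for n
      by (rule balanced_smooth[OF sol a \<psi>(1-4)])
    show "\<psi> n \<in> borel_measurable borel" for n
      using \<psi>(1)[of n] by (intro borel_measurable_continuous_onI DERIV_continuous_on) auto
  qed
qed

text \<open>The balance of the total mass. The constant weight does not vanish far to the right, so
  it is reached as a limit of half lines.\<close>

lemma balanced_one:
  assumes sol: "linear_weak_solution \<mu> \<tau> a b \<rho>\<^sub>0 \<rho>" and a: "continuous_on {0..} a"
    and \<rho>0: "set_integrable lborel {0..} \<rho>\<^sub>0"
  shows "balanced \<mu> \<tau> a b \<rho>\<^sub>0 \<rho> (\<lambda>_. 1)"
proof (rule balanced_limit[OF _ a \<rho>0])
  show "continuous_into_L1 \<rho>" using sol by (simp add: linear_weak_solution_def)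
  show "balanced \<mu> \<tau> a b \<rho>\<^sub>0 \<rho> (indicator {..real n})" for n
    by (rule balanced_atMost[OF assms])
  fix x :: real
  obtain n0 :: nat where "x < real n0" using reals_Archimedean2 by blast
  then have "\<forall>\<^sub>F n in sequentially. indicator {..real n} x = (1::real)"
    unfolding eventually_sequentially by (intro exI[of _ n0]) auto
  then show "(\<lambda>n. indicator {..real n} x :: real) \<longlonglongrightarrow> 1"
    by (rule tendsto_eventually)
qed (auto simp: indicator_def)

section \<open>Integral equations in time\<close>

text \<open>Continuity of \<open>X\<close> makes the right-hand side differentiable, so X' = b -
  \<mu> X. The deviation from the equilibrium \<open>b / \<mu>\<close>, multiplied by exp(\<mu> t),
  is then constant.\<close>

lemma linear_integral_equation:
  fixes X :: "real \<Rightarrow> real"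
  assumes eq: "\<And>t. t \<in> {t1..t2} \<Longrightarrow> X t = X1 + (LINT u:{t1..t}|lborel. b - \<mu> * X u)"
    and cont: "continuous_on {t1..t2} X" and "t1 \<le> t2" "\<mu> \<noteq> 0"
  shows "X t2 = exp (- \<mu> * (t2 - t1)) * X1 + b * (1 - exp (- \<mu> * (t2 - t1))) / \<mu>"
proof -
  have cq: "continuous_on {t1..t2} (\<lambda>u. b - \<mu> * X u)"
    using cont by (intro continuous_intros)
  have X: "X t = X1 + integral {t1..t} (\<lambda>u. b - \<mu> * X u)" if t: "t \<in> {t1..t2}" for t
  proof -
    have "set_integrable lborel {t1..t} (\<lambda>u. b - \<mu> * X u)"
      by (rule borel_integrable_atLeastAtMost') (use cq t in \<open>auto intro: continuous_on_subset\<close>)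
    then show ?thesis using eq[OF t] by (simp add: set_borel_integral_eq_integral)
  qed
  have dX: "(X has_real_derivative b - \<mu> * X t) (at t within {t1..t2})" if t: "t \<in> {t1..t2}" for t
  proof (rule has_field_derivative_transform_within[OF _ zero_less_one t])
    show "((\<lambda>t. X1 + integral {t1..t} (\<lambda>u. b - \<mu> * X u)) has_real_derivative b - \<mu> * X t) (at t within {t1..t2})"
      using integral_has_real_derivative[OF cq t] by (auto intro!: derivative_eq_intros)
  qed (rule X[symmetric])
  define Y where "Y = (\<lambda>t. exp (\<mu> * t) * (X t - b / \<mu>))"
  have "(Y has_real_derivative 0) (at t within {t1..t2})" if t: "t \<in> {t1..t2}" for t
    unfolding Y_def using \<open>\<mu> \<noteq> 0\<close>
    by (auto intro!: derivative_eq_intros dX[OF t] simp: field_simps)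
  then obtain k where k: "\<And>t. t \<in> {t1..t2} \<Longrightarrow> Y t = k"
    using has_field_derivative_zero_constant[of "{t1..t2}" Y] by auto
  have "Y t2 = Y t1" using k \<open>t1 \<le> t2\<close> by simp
  moreover have "X t1 = X1" using X[of t1] \<open>t1 \<le> t2\<close> by simp
  ultimately have "exp (\<mu> * t2) * (X t2 - b / \<mu>) = exp (\<mu> * t1) * (X1 - b / \<mu>)"
    by (simp add: Y_def)
  then have "exp (- (\<mu> * t2)) * (exp (\<mu> * t2) * (X t2 - b / \<mu>)) = exp (- (\<mu> * t2)) * (exp (\<mu> * t1) * (X1 - b / \<mu>))"
    by simp
  then have "X t2 - b / \<mu> = exp (- \<mu> * (t2 - t1)) * (X1 - b / \<mu>)"
    unfolding mult.assoc[symmetric] exp_add[symmetric] by (simp add: right_diff_distrib)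
  then show ?thesis using \<open>\<mu> \<noteq> 0\<close> by (simp add: field_simps)
qed

text \<open>Picard iteration in the norm weighted with \<open>exp (2 K t)\<close>; the integrands need not be
  integrable, since non-integrable ones have integral \<open>0\<close>.\<close>

lemma gronwall_zero:
  fixes D w :: "real \<Rightarrow> 'a \<Rightarrow> real"
  assumes bound: "\<And>t z. 0 \<le> t \<Longrightarrow> t \<le> T \<Longrightarrow> \<bar>D t z\<bar> \<le> B"
    and eq: "\<And>t z. 0 \<le> t \<Longrightarrow> t \<le> T \<Longrightarrow> D t z = (LINT u:{0..t}|lborel. w u z)"
    and w: "\<And>u z M. 0 \<le> u \<Longrightarrow> u \<le> T \<Longrightarrow> (\<And>z'. \<bar>D u z'\<bar> \<le> M) \<Longrightarrow> \<bar>w u z\<bar> \<le> K * M"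
    and "K > 0" "T \<ge> 0"
  shows "D T z = 0"
proof -
  have B: "B \<ge> 0" using bound[of 0 z] \<open>T \<ge> 0\<close> by linarith
  \<comment> \<open>Integrating K exp(2 K u) produces at most half of exp(2 K t), so every pass
    through the equation halves the constant.\<close>
  have it: "\<bar>D t z\<bar> \<le> B / 2 ^ n * exp (2 * K * t)" if "0 \<le> t" "t \<le> T" for n t z
    using that
  proof (induction n arbitrary: t z)
    case 0
    have "B * 1 \<le> B * exp (2 * K * t)"
      using 0 B \<open>K > 0\<close> by (intro mult_left_mono) auto
    then show ?case using bound[OF 0, of z] by simp
  next
    case (Suc n)
    let ?M = "\<lambda>u. B / 2 ^ n * exp (2 * K * u)"
    let ?F = "\<lambda>u. B / 2 ^ Suc n * exp (2 * K * u)"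
    have cM: "continuous_on {0..} (\<lambda>u. K * ?M u)" by (intro continuous_intros) auto
    have iM: "integrable lborel (\<lambda>u. indicator {0..t} u *\<^sub>R (K * ?M u))"
      unfolding set_integrable_def[symmetric] by (rule set_integrable_continuous_Icc[OF cM]) simp
    have wM: "norm (indicator {0..t} u *\<^sub>R w u z) \<le> indicator {0..t} u *\<^sub>R (K * ?M u)" for u
      using w[of u "?M u" z] Suc.IH[of u] Suc.prems by (auto simp: indicator_def)
    have "\<bar>D t z\<bar> \<le> (LINT u:{0..t}|lborel. K * ?M u)"
    proof (cases "integrable lborel (\<lambda>u. indicator {0..t} u *\<^sub>R w u z)")
      case True
      show ?thesis
        using Bochner_Integration.integral_norm_bound_integral[OF True iM wM]
        unfolding eq[OF Suc.prems, of z] set_lebesgue_integral_def by (simp only: real_norm_def)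
    next
      case False
      then have "D t z = 0"
        using eq[OF Suc.prems] by (simp add: set_lebesgue_integral_def not_integrable_integral_eq)
      moreover have "0 \<le> (LINT u:{0..t}|lborel. K * ?M u)"
        unfolding set_lebesgue_integral_def using B \<open>K > 0\<close> by (intro integral_nonneg_AE) auto
      ultimately show ?thesis by simp
    qed
    also have "(LINT u:{0..t}|lborel. K * ?M u) = ?F t - ?F 0"
      by (rule set_integral_derivative[OF _ cM]) (use Suc.prems in \<open>auto intro!: derivative_eq_intros\<close>)
    also have "\<dots> \<le> ?F t" using B by simp
    finally show ?case .
  qed
  have "(\<lambda>n. B * exp (2 * K * T) * (1 / 2) ^ n) \<longlonglongrightarrow> B * exp (2 * K * T) * 0"
    by (intro tendsto_mult tendsto_const LIMSEQ_realpow_zero) auto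
  then have "\<bar>D T z\<bar> \<le> 0"
    using it[of T z] \<open>T \<ge> 0\<close>
    by (intro LIMSEQ_le_const[of _ 0]) (auto simp: power_one_over field_simps)
  then show ?thesis by simp
qed

section \<open>Masses to the left of a characteristic and above the threshold\<close>

lemma AE_lborel_neq: "AE s in lborel. s \<noteq> (x::real)"
  using AE_lborel_singleton[of x] by simp

lemma eligible_mass_altdef:
  assumes "\<tau> \<ge> 0"
  shows "eligible_mass \<tau> f = (LINT s:{0..}|lborel. f s * indicator {\<tau>..} s)"
  unfolding eligible_mass_def set_lebesgue_integral_def
  by (rule Bochner_Integration.integral_cong) (use assms in \<open>auto split: split_indicator\<close>)

lemma eligible_weighted_mass_one:
  assumes "\<tau> \<ge> 0"
  shows "eligible_weighted_mass \<tau> \<rho> (\<lambda>_. 1) t = eligible_mass \<tau> (\<rho> t)"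
  unfolding eligible_mass_altdef[OF assms] eligible_weighted_mass_def by simp

lemma continuous_on_eligible_mass:
  assumes "continuous_into_L1 \<rho>" "\<tau> \<ge> 0"
  shows "continuous_on {0..} (\<lambda>t. eligible_mass \<tau> (\<rho> t))"
  unfolding eligible_mass_altdef[OF assms(2)]
  by (rule continuous_on_weighted_mass[OF assms(1), where K=1]) (auto simp: indicator_def)

text \<open>At a given time the weight is discontinuous in time only for the single seniority
  \<open>s = y + t\<close>, a null set.\<close>

lemma continuous_on_weighted_mass_atMost:
  assumes "continuous_into_L1 \<rho>"
  shows "continuous_on {0..} (weighted_mass \<rho> (indicator {..y}))"
  unfolding weighted_mass_def
proof (rule continuous_on_weighted_mass[OF assms, where K=1])
  fix t :: real assume "t \<ge> 0"
  show "AE s in lborel. continuous (at t within {0..}) (\<lambda>u. indicator {..y} (s - u) :: real)"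
    using AE_lborel_neq[of "y + t"]
  proof eventually_elim
    case (elim s)
    then consider "s - t < y" | "s - t > y" by linarith
    then have "isCont (\<lambda>u. indicator {..y} (s - u) :: real) t"
    proof cases
      case 1
      have "\<forall>\<^sub>F u in nhds t. u \<in> {s - y<..}" using 1 by (intro eventually_nhds_in_open) auto
      then have "\<forall>\<^sub>F u in nhds t. indicator {..y} (s - u) = (1::real)"
        by eventually_elim auto
      then show ?thesis by (subst isCont_cong) auto
    next
      case 2
      have "\<forall>\<^sub>F u in nhds t. u \<in> {..<s - y}" using 2 by (intro eventually_nhds_in_open) auto
      then have "\<forall>\<^sub>F u in nhds t. indicator {..y} (s - u) = (0::real)"
        by eventually_elim auto
      then show ?thesis by (subst isCont_cong) auto
    qed
    then show ?case by (rule continuous_at_imp_continuous_within)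
  qed
qed (auto simp: indicator_def)

lemma continuous_on_total_mass:
  assumes "continuous_into_L1 \<rho>"
  shows "continuous_on {0..} (weighted_mass \<rho> (\<lambda>_. 1))"
  by (rule continuous_on_weighted_mass_smooth(1)[OF assms]) auto

text \<open>The characteristic at seniority \<open>\<tau>\<close> at time \<open>t\<close> has label
  \<open>\<tau> - t\<close>. This expresses the promotion term through the half-line masses
  themselves, at two labels, and so closes the system of balance laws. The identity holds up to the
  point \<open>s = \<tau>\<close>, which lies in both closed half lines.\<close>

lemma eligible_weighted_mass_atMost:
  assumes \<rho>: "continuous_into_L1 \<rho>" and "\<tau> \<ge> 0" and t: "t \<ge> 0"
  shows "eligible_weighted_mass \<tau> \<rho> (indicator {..y}) t =
    (if \<tau> \<le> y + t then weighted_mass \<rho> (indicator {..y}) t - weighted_mass \<rho> (indicator {..\<tau> - t}) t else 0)"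
proof (cases "\<tau> \<le> y + t")
  case True
  have i: "set_integrable lborel {0..} (\<lambda>s. \<rho> t s * indicator {..z} (s - t))" for z
    by (rule set_integrable_mult_bounded[OF continuous_into_L1D[OF \<rho> t], where K=1]) (auto simp: indicator_def)
  have j: "set_integrable lborel {0..} (\<lambda>s. \<rho> t s * (indicator {\<tau>..} s * indicator {..y} (s - t)))"
    by (rule set_integrable_mult_bounded[OF continuous_into_L1D[OF \<rho> t], where K=1]) (auto simp: indicator_def)
  have "eligible_weighted_mass \<tau> \<rho> (indicator {..y}) t =
      (LINT s:{0..}|lborel. \<rho> t s * indicator {..y} (s - t) - \<rho> t s * indicator {..\<tau> - t} (s - t))"
    unfolding eligible_weighted_mass_def set_lebesgue_integral_def
  proof (rule integral_cong_AE)
    show "AE s in lborel. indicator {0..} s *\<^sub>R (\<rho> t s * (indicator {\<tau>..} s * indicator {..y} (s - t))) =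
        indicator {0..} s *\<^sub>R (\<rho> t s * indicator {..y} (s - t) - \<rho> t s * indicator {..\<tau> - t} (s - t))"
      using AE_lborel_neq[of \<tau>] by eventually_elim (use True in \<open>auto split: split_indicator\<close>)
  qed (use set_integral_diff(1)[OF i i, of y "\<tau> - t"] j in \<open>auto simp: set_integrable_def\<close>)
  also have "\<dots> = weighted_mass \<rho> (indicator {..y}) t - weighted_mass \<rho> (indicator {..\<tau> - t}) t"
    unfolding weighted_mass_def by (rule set_integral_diff(2)[OF i i])
  finally show ?thesis using True by simp
next
  case False
  then have "(\<lambda>s. \<rho> t s * (indicator {\<tau>..} s * indicator {..y} (s - t))) = (\<lambda>s. 0)"
    by (auto split: split_indicator)
  then show ?thesis using False unfolding eligible_weighted_mass_def by (simp only:) simp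
qed

text \<open>Splits the quantity that carries the nonlinearity into two that obey separate equations:
  the total mass and the mass up to seniority \<open>\<tau>\<close>.\<close>

lemma eligible_mass_eq_diff:
  assumes \<rho>: "continuous_into_L1 \<rho>" and \<tau>: "\<tau> \<ge> 0" and t: "t \<ge> 0"
  shows "eligible_mass \<tau> (\<rho> t) = weighted_mass \<rho> (\<lambda>_. 1) t - weighted_mass \<rho> (indicator {..\<tau> - t}) t"
proof -
  note j = continuous_into_L1D[OF \<rho> t]
  have i: "set_integrable lborel {0..} (\<lambda>s. \<rho> t s * indicator {..\<tau> - t} (s - t))"
    by (rule set_integrable_mult_bounded[OF j, where K=1]) (auto simp: indicator_def)
  have k: "set_integrable lborel {0..} (\<lambda>s. \<rho> t s * indicator {\<tau>..} s)"
    by (rule set_integrable_mult_bounded[OF j, where K=1]) (auto simp: indicator_def)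
  have "eligible_mass \<tau> (\<rho> t) = (LINT s:{0..}|lborel. \<rho> t s - \<rho> t s * indicator {..\<tau> - t} (s - t))"
    unfolding eligible_mass_altdef[OF \<tau>] set_lebesgue_integral_def
  proof (rule integral_cong_AE)
    show "AE s in lborel. indicator {0..} s *\<^sub>R (\<rho> t s * indicator {\<tau>..} s) =
        indicator {0..} s *\<^sub>R (\<rho> t s - \<rho> t s * indicator {..\<tau> - t} (s - t))"
      using AE_lborel_neq[of \<tau>] by eventually_elim (auto split: split_indicator)
  qed (use set_integral_diff(1)[OF j i] k in \<open>auto simp: set_integrable_def\<close>)
  then show ?thesis
    unfolding weighted_mass_def using set_integral_diff(2)[OF j i] by simp
qed

section \<open>The eligible mass and uniqueness\<close>

text \<open>The mass on \<open>[0, \<tau>]\<close> at time \<open>r \<le> \<tau>\<close>; from time \<open>\<tau>\<close> on it is constant.\<close>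

definition young_mass :: "real \<Rightarrow> real \<Rightarrow> real \<Rightarrow> (real \<Rightarrow> real) \<Rightarrow> real \<Rightarrow> real" where
  "young_mass \<mu> \<tau> b \<rho>\<^sub>0 r =
    exp (- \<mu> * r) * (LINT s:{0..}|lborel. \<rho>\<^sub>0 s * indicator {..\<tau> - r} s) + b * (1 - exp (- \<mu> * r)) / \<mu>"

lemma set_integral_atLeast_atMost_nonpos:
  fixes f :: "real \<Rightarrow> real"
  assumes "y \<le> 0"
  shows "(LINT s:{0..}|lborel. f s * indicator {..y} s) = 0"
  unfolding set_lebesgue_integral_def
proof (rule integral_eq_zero_AE)
  show "AE s in lborel. indicator {0..} s *\<^sub>R (f s * indicator {..y} s) = 0"
    using AE_lborel_neq[of 0] by eventually_elim (use assms in \<open>auto split: split_indicator\<close>)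
qed

text \<open>Follow the characteristic that reaches seniority \<open>\<tau>\<close> at time \<open>t\<close>: the mass to its left
  obeys \<open>X' = b - \<mu> X\<close> from the moment \<open>max 0 (t - \<tau>)\<close> on.\<close>

lemma weighted_mass_young:
  assumes sol: "linear_weak_solution \<mu> \<tau> a b \<rho>\<^sub>0 \<rho>" and a: "continuous_on {0..} a"
    and \<rho>0: "set_integrable lborel {0..} \<rho>\<^sub>0" and "\<tau> \<ge> 0" "\<mu> > 0" "t \<ge> 0"
  shows "weighted_mass \<rho> (indicator {..\<tau> - t}) t = young_mass \<mu> \<tau> b \<rho>\<^sub>0 (min t \<tau>)"
proof -
  have \<rho>: "continuous_into_L1 \<rho>" using sol by (simp add: linear_weak_solution_def)
  define y where "y = \<tau> - t"
  define t1 where "t1 = max 0 (t - \<tau>)"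
  define X where "X = weighted_mass \<rho> (indicator {..y})"
  let ?p = "eligible_weighted_mass \<tau> \<rho> (indicator {..y})"
  let ?q = "\<lambda>u. b * indicator {..y} (- u) - \<mu> * X u - a u * ?p u"
  define X1 where "X1 = (LINT s:{0..}|lborel. \<rho>\<^sub>0 s * indicator {..y} s)"
  have t1: "0 \<le> t1" "t1 \<le> t" using assms by (auto simp: t1_def)
  have bal: "set_integrable lborel {0..T} ?q" "X T = X1 + (LINT u:{0..T}|lborel. ?q u)" if "T \<ge> 0" for T
    using balanced_atMost[OF sol a \<rho>0, of y] that unfolding balanced_def X_def X1_def by auto
  \<comment> \<open>The characteristic stays below \<open>\<tau>\<close> before time
    \<open>t\<close>; at \<open>u = t\<close> it meets the eligible region only in the point
    \<open>\<tau>\<close>, and the two half-line masses cancel.\<close>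
  have p0: "?p u = 0" if "0 \<le> u" "u \<le> t" for u
    using eligible_weighted_mass_atMost[OF \<rho> \<open>\<tau> \<ge> 0\<close> that(1), of y] that by (auto simp: y_def)
  \<comment> \<open>Before \<open>t1\<close> the characteristic is still at negative seniority, with
    neither mass nor inflow to its left.\<close>
  have q0: "?q u = 0" if "0 \<le> u" "u < t1" for u
  proof -
    have u: "u < - y" using that by (auto simp: t1_def y_def)
    have "(\<lambda>s. indicator {0..} s *\<^sub>R (\<rho> u s * indicator {..y} (s - u))) = (\<lambda>s. 0)"
      using u by (auto split: split_indicator)
    then have "X u = 0"
      unfolding X_def weighted_mass_def set_lebesgue_integral_def by (simp only:) simp
    then show ?thesis using u p0[of u] that t1 by (auto split: split_indicator)
  qed
  have q1: "?q u = b - \<mu> * X u" if "t1 \<le> u" "u \<le> t" for u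
  proof -
    have "- u \<le> y" using that by (auto simp: t1_def y_def)
    then show ?thesis using p0[of u] that t1 by auto
  qed
  have X: "X T = X1 + (LINT u:{t1..T}|lborel. b - \<mu> * X u)" if T: "T \<in> {t1..t}" for T
  proof -
    have T0: "T \<ge> 0" using T t1 by auto
    have "{0..T} = {0..<t1} \<union> {t1..T}" using T t1 by auto
    moreover have "(LINT u:{0..<t1} \<union> {t1..T}|lborel. ?q u) = (LINT u:{0..<t1}|lborel. ?q u) + (LINT u:{t1..T}|lborel. ?q u)"
      by (rule set_integral_Un) (use T t1 in \<open>auto intro!: set_integrable_subset[OF bal(1)[OF T0]]\<close>)
    moreover have "(LINT u:{0..<t1}|lborel. ?q u) = (LINT u:{0..<t1}|lborel. 0)"
      by (rule set_lebesgue_integral_cong) (use q0 in auto)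
    moreover have "(LINT u:{t1..T}|lborel. ?q u) = (LINT u:{t1..T}|lborel. b - \<mu> * X u)"
      by (rule set_lebesgue_integral_cong) (use q1 T in auto)
    ultimately show ?thesis using bal(2)[OF T0] by simp
  qed
  have "continuous_on {0..} X"
    unfolding X_def by (rule continuous_on_weighted_mass_atMost[OF \<rho>])
  then have "continuous_on {t1..t} X" by (rule continuous_on_subset) (use t1 in auto)
  from linear_integral_equation[OF X this t1(2)] \<open>\<mu> > 0\<close>
  have "X t = exp (- \<mu> * (t - t1)) * X1 + b * (1 - exp (- \<mu> * (t - t1))) / \<mu>" by simp
  moreover have "t - t1 = min t \<tau>" by (auto simp: t1_def)
  \<comment> \<open>For \<open>t > \<tau>\<close> the label \<open>y\<close> is negative, and both
    integrals run over null sets.\<close>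
  moreover have "X1 = (LINT s:{0..}|lborel. \<rho>\<^sub>0 s * indicator {..\<tau> - min t \<tau>} s)"
  proof (cases "t \<le> \<tau>")
    case True
    then show ?thesis by (simp add: X1_def y_def)
  next
    case False
    then show ?thesis by (simp add: X1_def y_def set_integral_atLeast_atMost_nonpos)
  qed
  ultimately show ?thesis unfolding young_mass_def X_def y_def by simp
qed

text \<open>The rate contains the unknown eligible mass, but multiplied by that mass it is
  \<open>c\<close>, so the balance of the total mass is a closed equation. Since
  \<open>b - c = \<mu> * N\<close>, its equilibrium is \<open>N\<close>, which is also the initial
  value.\<close>

lemma weak_solution_eligible_mass:
  assumes sol: "weak_solution \<mu> \<tau> c b \<rho>\<^sub>0 \<rho>" and \<rho>0: "set_integrable lborel {0..} \<rho>\<^sub>0"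
    and N: "(LINT s:{0..}|lborel. \<rho>\<^sub>0 s) = N" and b: "b = \<mu> * N + c"
    and \<tau>: "\<tau> \<ge> 0" and \<mu>: "\<mu> > 0" and t: "t \<ge> 0"
  shows "eligible_mass \<tau> (\<rho> t) = N - young_mass \<mu> \<tau> b \<rho>\<^sub>0 (min t \<tau>)"
proof -
  let ?a = "\<lambda>t. c / eligible_mass \<tau> (\<rho> t)"
  have lin: "linear_weak_solution \<mu> \<tau> ?a b \<rho>\<^sub>0 \<rho>" and pos: "\<And>t. t \<ge> 0 \<Longrightarrow> eligible_mass \<tau> (\<rho> t) > 0"
    using sol by (auto simp: weak_solution_iff_linear)
  have \<rho>: "continuous_into_L1 \<rho>" using lin by (simp add: linear_weak_solution_def)
  have a: "continuous_on {0..} ?a"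
    using continuous_on_eligible_mass[OF \<rho> \<tau>] pos by (force intro!: continuous_intros)
  let ?M = "weighted_mass \<rho> (\<lambda>_. 1)"
  have M: "?M T = N + (LINT u:{0..T}|lborel. \<mu> * N - \<mu> * ?M u)" if "T \<ge> 0" for T
  proof -
    have "?M T = (LINT s:{0..}|lborel. \<rho>\<^sub>0 s * 1) +
        (LINT u:{0..T}|lborel. b * 1 - \<mu> * ?M u - ?a u * eligible_weighted_mass \<tau> \<rho> (\<lambda>_. 1) u)"
      using balanced_one[OF lin a \<rho>0] that unfolding balanced_def by blast
    also have "(LINT u:{0..T}|lborel. b * 1 - \<mu> * ?M u - ?a u * eligible_weighted_mass \<tau> \<rho> (\<lambda>_. 1) u)
        = (LINT u:{0..T}|lborel. \<mu> * N - \<mu> * ?M u)"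
    proof (rule set_lebesgue_integral_cong, simp, intro allI impI)
      fix u assume "u \<in> {0..T}"
      then show "b * 1 - \<mu> * ?M u - ?a u * eligible_weighted_mass \<tau> \<rho> (\<lambda>_. 1) u = \<mu> * N - \<mu> * ?M u"
        using pos[of u] by (simp add: eligible_weighted_mass_one[OF \<tau>] b)
    qed
    finally show ?thesis using N by simp
  qed
  have "continuous_on {0..t} ?M"
    by (rule continuous_on_subset[OF continuous_on_total_mass[OF \<rho>]]) auto
  from linear_integral_equation[OF M this] t \<mu>
  have "?M t = exp (- \<mu> * t) * N + \<mu> * N * (1 - exp (- \<mu> * t)) / \<mu>" by simp
  then have "?M t = N" using \<mu> by (simp add: field_simps)
  then show ?thesis
    using eligible_mass_eq_diff[OF \<rho> \<tau> t] weighted_mass_young[OF lin a \<rho>0 \<tau> \<mu> t] by simp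
qed

lemma continuous_on_bounded_Icc:
  fixes f :: "real \<Rightarrow> real"
  assumes "continuous_on {0..} f"
  obtains B where "B > 0" "\<And>t. 0 \<le> t \<Longrightarrow> t \<le> T \<Longrightarrow> \<bar>f t\<bar> \<le> B"
proof -
  have "bounded (f ` {0..T})"
    by (intro compact_imp_bounded compact_continuous_image continuous_on_subset[OF assms]) auto
  then show thesis using that by (auto simp: bounded_pos)
qed

text \<open>Here the promoted flow \<open>a t * eligible_mass \<tau> (\<rho> t)\<close> is not known
  to be \<open>c\<close> beforehand. By \<open>ac\<close> it differs from \<open>c\<close> by
  \<open>a t\<close> times the deviation of the total mass from \<open>N\<close>, so this deviation
  solves a homogeneous equation with coefficient -(\<mu> + a) and vanishes.\<close>

lemma linear_solution_eligible_mass: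
  assumes sol: "linear_weak_solution \<mu> \<tau> a b \<rho>\<^sub>0 \<rho>" and a: "continuous_on {0..} a"
    and \<rho>0: "set_integrable lborel {0..} \<rho>\<^sub>0"
    and N: "(LINT s:{0..}|lborel. \<rho>\<^sub>0 s) = N" and b: "b = \<mu> * N + c"
    and \<tau>: "\<tau> \<ge> 0" and \<mu>: "\<mu> > 0" and t: "t \<ge> 0"
    and ac: "\<And>t. t \<ge> 0 \<Longrightarrow> a t * (N - young_mass \<mu> \<tau> b \<rho>\<^sub>0 (min t \<tau>)) = c"
  shows "eligible_mass \<tau> (\<rho> t) = N - young_mass \<mu> \<tau> b \<rho>\<^sub>0 (min t \<tau>)"
proof -
  have \<rho>: "continuous_into_L1 \<rho>" using sol by (simp add: linear_weak_solution_def)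
  let ?M = "weighted_mass \<rho> (\<lambda>_. 1)"
  have E: "eligible_mass \<tau> (\<rho> u) = ?M u - young_mass \<mu> \<tau> b \<rho>\<^sub>0 (min u \<tau>)" if "u \<ge> 0" for u
    using eligible_mass_eq_diff[OF \<rho> \<tau> that] weighted_mass_young[OF sol a \<rho>0 \<tau> \<mu> that] by simp
  obtain B where B: "B > 0" "\<And>u. 0 \<le> u \<Longrightarrow> u \<le> t \<Longrightarrow> \<bar>?M u - N\<bar> \<le> B"
    using continuous_on_bounded_Icc[OF continuous_on_diff[OF continuous_on_total_mass[OF \<rho>] continuous_on_const]] by metis
  obtain K where K: "K > 0" "\<And>u. 0 \<le> u \<Longrightarrow> u \<le> t \<Longrightarrow> \<bar>- (\<mu> + a u)\<bar> \<le> K"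
    using continuous_on_bounded_Icc[OF continuous_on_minus[OF continuous_on_add[OF continuous_on_const a]]] by metis
  have "?M t - N = 0"
  proof (rule gronwall_zero[where D="\<lambda>u _. ?M u - N" and T=t and B=B and K=K and w="\<lambda>u _. - (\<mu> + a u) * (?M u - N)"])
    fix T assume T: "0 \<le> T" "T \<le> t"
    have "?M T = (LINT s:{0..}|lborel. \<rho>\<^sub>0 s * 1) +
        (LINT u:{0..T}|lborel. b * 1 - \<mu> * ?M u - a u * eligible_weighted_mass \<tau> \<rho> (\<lambda>_. 1) u)"
      using balanced_one[OF sol a \<rho>0] T unfolding balanced_def by blast
    also have "(LINT u:{0..T}|lborel. b * 1 - \<mu> * ?M u - a u * eligible_weighted_mass \<tau> \<rho> (\<lambda>_. 1) u)
        = (LINT u:{0..T}|lborel. - (\<mu> + a u) * (?M u - N))"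
    proof (rule set_lebesgue_integral_cong, simp, intro allI impI)
      fix u assume "u \<in> {0..T}"
      then have u: "u \<ge> 0" by simp
      show "b * 1 - \<mu> * ?M u - a u * eligible_weighted_mass \<tau> \<rho> (\<lambda>_. 1) u = - (\<mu> + a u) * (?M u - N)"
        unfolding eligible_weighted_mass_one[OF \<tau>] E[OF u] using ac[OF u] b by (simp add: algebra_simps)
    qed
    finally show "?M T - N = (LINT u:{0..T}|lborel. - (\<mu> + a u) * (?M u - N))" using N by simp
  next
    fix u :: real and z :: unit and M' assume "0 \<le> u" "u \<le> t" "\<And>z'::unit. \<bar>?M u - N\<bar> \<le> M'"
    then show "\<bar>- (\<mu> + a u) * (?M u - N)\<bar> \<le> K * M'"
      using K(2)[of u] K(1) unfolding abs_mult by (intro mult_mono) simp_all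
  qed (use B K t in auto)
  then show ?thesis using E[OF t] by simp
qed

text \<open>Closed half lines are stable under intersection and generate the Borel sets, and the
  sets over which \<open>f\<close> integrates to 0 form a Dynkin system. Complements need the total
  integral to be 0, which is the limit over growing half lines.\<close>

lemma AE_eq_zero_if_integral_atMost_zero:
  fixes f :: "real \<Rightarrow> real"
  assumes f: "integrable lborel f" and zero: "\<And>y. (LINT s|lborel. f s * indicator {..y} s) = 0"
  shows "AE s in lborel. f s = 0"
proof (rule sigma_finite_measure.density_zero[OF lborel.sigma_finite_measure_axioms f])
  have i: "integrable lborel (\<lambda>s. indicator A s *\<^sub>R f s)" if "A \<in> sets borel" for A
    using that f by (intro integrable_mult_indicator) auto
  have tot: "(LINT s|lborel. f s) = 0"
  proof -
    have "set_integrable lborel UNIV f" using f by (simp add: set_integrable_def)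
    then have "(\<lambda>n::nat. LINT s:UNIV|lborel. f s * indicator {..real n} s) \<longlonglongrightarrow> (LINT s:UNIV|lborel. f s * 1)"
    proof (rule set_integral_bounded_convergence[where K=1])
      show "AE s in lborel. (\<lambda>n. indicator {..real n} s :: real) \<longlonglongrightarrow> 1"
      proof (intro AE_I2 tendsto_eventually)
        fix s :: real
        obtain n0 :: nat where "s < real n0" using reals_Archimedean2 by blast
        then show "\<forall>\<^sub>F n in sequentially. indicator {..real n} s = (1::real)"
          unfolding eventually_sequentially by (intro exI[of _ n0]) auto
      qed
    qed (auto simp: indicator_def)
    then show ?thesis
      using zero by (simp add: set_lebesgue_integral_def LIMSEQ_const_iff)
  qed
  fix A assume "A \<in> sets (lborel :: real measure)"
  then have A: "A \<in> sigma_sets UNIV (range atMost)"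
    by (simp add: borel_eq_atMost)
  have stable: "Int_stable (range (atMost :: real \<Rightarrow> _))"
    by (auto simp: Int_stable_def intro!: image_eqI)
  have "range atMost \<subseteq> Pow (UNIV :: real set)" by simp
  from stable this A have "(LINT s|lborel. indicator A s *\<^sub>R f s) = 0"
  proof (induction rule: sigma_sets_induct_disjoint)
    case (basic A)
    then show ?case using zero by (auto simp: mult.commute)
  next
    case (compl A)
    then have A: "A \<in> sets borel" by (simp add: borel_eq_atMost)
    have "(LINT s|lborel. indicator (UNIV - A) s *\<^sub>R f s) = (LINT s|lborel. f s - indicator A s *\<^sub>R f s)"
      by (rule Bochner_Integration.integral_cong) (auto split: split_indicator)
    also have "\<dots> = 0" using compl tot i[OF A] f by simp
    finally show ?case .
  next
    case (union A)
    then have A: "A n \<in> sets borel" for n by (auto simp: borel_eq_atMost)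
    have "(LINT s:(\<Union>n. A n)|lborel. f s) = (\<Sum>n. LINT s:A n|lborel. f s)"
    proof (rule lebesgue_integral_countable_add)
      show "set_integrable lborel (\<Union>n. A n) f" unfolding set_integrable_def using A by (intro i) auto
    qed (use A union in \<open>auto simp: disjoint_family_on_def\<close>)
    then show ?case using union by (simp add: set_lebesgue_integral_def)
  qed auto
  then show "(LINT s:A|lborel. f s) = 0" by (simp add: set_lebesgue_integral_def)
qed

text \<open>The data cancel in the difference of two balances. The equation for label
  \<open>y\<close> also involves label \<open>\<tau> - u\<close>, so no single label gives a closed
  inequality; the estimate is uniform in the label, which is the parameter \<open>z\<close> of
  \<open>gronwall_zero\<close>.\<close>

lemma linear_weak_solution_unique:
  assumes sol: "linear_weak_solution \<mu> \<tau> a b \<rho>\<^sub>0 \<rho>" and sol': "linear_weak_solution \<mu> \<tau> a b \<rho>\<^sub>0 \<rho>'"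
    and a: "continuous_on {0..} a" and \<rho>0: "set_integrable lborel {0..} \<rho>\<^sub>0"
    and \<tau>: "\<tau> \<ge> 0" and t: "t \<ge> 0"
  shows "AE s in lborel. s \<ge> 0 \<longrightarrow> \<rho>' t s = \<rho> t s"
proof -
  have \<rho>: "continuous_into_L1 \<rho>" and \<rho>': "continuous_into_L1 \<rho>'"
    using sol sol' by (auto simp: linear_weak_solution_def)
  let ?F = "\<lambda>\<rho> u y. weighted_mass \<rho> (indicator {..y}) u"
  let ?p = "\<lambda>\<rho> y u. eligible_weighted_mass \<tau> \<rho> (indicator {..y}) u"
  let ?q = "\<lambda>\<rho> y u. b * indicator {..y} (- u) - \<mu> * ?F \<rho> u y - a u * ?p \<rho> y u"
  obtain B where B: "\<And>u. 0 \<le> u \<Longrightarrow> u \<le> t \<Longrightarrow> \<bar>LINT s:{0..}|lborel. \<bar>\<rho> u s\<bar>\<bar> \<le> B"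
    using continuous_on_bounded_Icc[OF continuous_on_L1_norm[OF \<rho>]] by metis
  obtain B' where B': "\<And>u. 0 \<le> u \<Longrightarrow> u \<le> t \<Longrightarrow> \<bar>LINT s:{0..}|lborel. \<bar>\<rho>' u s\<bar>\<bar> \<le> B'"
    using continuous_on_bounded_Icc[OF continuous_on_L1_norm[OF \<rho>']] by metis
  obtain K where K: "K > 0" "\<And>u. 0 \<le> u \<Longrightarrow> u \<le> t \<Longrightarrow> \<bar>a u\<bar> \<le> K"
    using continuous_on_bounded_Icc[OF a] by metis
  have D: "?F \<rho> t y - ?F \<rho>' t y = 0" for y
  proof (rule gronwall_zero[where D="\<lambda>t y. ?F \<rho> t y - ?F \<rho>' t y" and T=t and B="B + B'" and K="\<bar>\<mu>\<bar> + 2 * K"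
        and w="\<lambda>u y. ?q \<rho> y u - ?q \<rho>' y u"])
    fix T y assume T: "0 \<le> T" "T \<le> t"
    have "\<bar>?F \<rho> T y\<bar> \<le> (LINT s:{0..}|lborel. \<bar>\<rho> T s\<bar>)" "\<bar>?F \<rho>' T y\<bar> \<le> (LINT s:{0..}|lborel. \<bar>\<rho>' T s\<bar>)"
      by (auto intro!: weighted_mass_bound \<rho> \<rho>' T simp: indicator_def)
    then show "\<bar>?F \<rho> T y - ?F \<rho>' T y\<bar> \<le> B + B'"
      using B[OF T] B'[OF T] by linarith
    have "set_integrable lborel {0..T} (?q \<rho> y)" "set_integrable lborel {0..T} (?q \<rho>' y)"
      "?F \<rho> T y = (LINT s:{0..}|lborel. \<rho>\<^sub>0 s * indicator {..y} s) + (LINT u:{0..T}|lborel. ?q \<rho> y u)"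
      "?F \<rho>' T y = (LINT s:{0..}|lborel. \<rho>\<^sub>0 s * indicator {..y} s) + (LINT u:{0..T}|lborel. ?q \<rho>' y u)"
      using balanced_atMost[OF sol a \<rho>0, of y] balanced_atMost[OF sol' a \<rho>0, of y] T
      unfolding balanced_def by blast+
    note * = this
    show "?F \<rho> T y - ?F \<rho>' T y = (LINT u:{0..T}|lborel. ?q \<rho> y u - ?q \<rho>' y u)"
      unfolding set_integral_diff(2)[OF *(1,2)] using *(3,4) by linarith
  next
    fix u y M assume u: "0 \<le> u" "u \<le> t" and M: "\<And>z. \<bar>?F \<rho> u z - ?F \<rho>' u z\<bar> \<le> M"
    let ?D = "\<lambda>z. ?F \<rho> u z - ?F \<rho>' u z"
    have M0: "0 \<le> M" using M[of 0] by linarith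
    \<comment> \<open>An eligible mass is a difference of two half-line masses; hence the term
      \<open>2 * K\<close> in the Gronwall constant.\<close>
    have p: "\<bar>?p \<rho> y u - ?p \<rho>' y u\<bar> \<le> 2 * M"
      unfolding eligible_weighted_mass_atMost[OF \<rho> \<tau> u(1)] eligible_weighted_mass_atMost[OF \<rho>' \<tau> u(1)]
      using M[of y] M[of "\<tau> - u"] M0 by (auto split: if_splits)
    have "\<bar>\<mu> * ?D y\<bar> \<le> \<bar>\<mu>\<bar> * M"
      unfolding abs_mult by (rule mult_left_mono[OF M abs_ge_zero])
    moreover have "\<bar>a u * (?p \<rho> y u - ?p \<rho>' y u)\<bar> \<le> K * (2 * M)"
      unfolding abs_mult by (rule mult_mono[OF K(2)[OF u] p]) (use K in simp_all)
    moreover have "?q \<rho> y u - ?q \<rho>' y u = - (\<mu> * ?D y) - a u * (?p \<rho> y u - ?p \<rho>' y u)"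
      by (simp add: algebra_simps)
    moreover have "(\<bar>\<mu>\<bar> + 2 * K) * M = \<bar>\<mu>\<bar> * M + K * (2 * M)"
      by (simp add: algebra_simps)
    ultimately show "\<bar>?q \<rho> y u - ?q \<rho>' y u\<bar> \<le> (\<bar>\<mu>\<bar> + 2 * K) * M"
      by linarith
  qed (use K t in auto)
  note i = continuous_into_L1D[OF \<rho> t] continuous_into_L1D[OF \<rho>' t]
  have "AE s in lborel. indicator {0..} s *\<^sub>R (\<rho>' t s - \<rho> t s) = 0"
  proof (rule AE_eq_zero_if_integral_atMost_zero)
    show "integrable lborel (\<lambda>s. indicator {0..} s *\<^sub>R (\<rho>' t s - \<rho> t s))"
      using set_integral_diff(1)[OF i(2,1)] by (simp add: set_integrable_def)
    fix y
    have j: "set_integrable lborel {0..} (\<lambda>s. \<rho> t s * indicator {..y - t} (s - t))"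
      "set_integrable lborel {0..} (\<lambda>s. \<rho>' t s * indicator {..y - t} (s - t))"
      by (auto intro!: set_integrable_mult_bounded[where K=1] i simp: indicator_def)
    \<comment> \<open>Seniority up to \<open>y\<close> at time \<open>t\<close> means label up to
      \<open>y - t\<close>.\<close>
    have "(LINT s|lborel. indicator {0..} s *\<^sub>R (\<rho>' t s - \<rho> t s) * indicator {..y} s) =
        (LINT s:{0..}|lborel. \<rho>' t s * indicator {..y - t} (s - t) - \<rho> t s * indicator {..y - t} (s - t))"
      unfolding set_lebesgue_integral_def
      by (rule Bochner_Integration.integral_cong) (auto split: split_indicator)
    also have "\<dots> = ?F \<rho>' t (y - t) - ?F \<rho> t (y - t)"
      unfolding weighted_mass_def by (rule set_integral_diff(2)[OF j(2,1)])
    finally show "(LINT s|lborel. indicator {0..} s *\<^sub>R (\<rho>' t s - \<rho> t s) * indicator {..y} s) = 0"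
      using D[of "y - t"] by simp
  qed
  then show ?thesis by eventually_elim (auto split: split_indicator_asm)
qed

section \<open>Continuity of translations in \<open>L\<^sup>1\<close>\<close>

lemma lborel_integrable_shift:
  fixes f :: "real \<Rightarrow> real"
  assumes "integrable lborel f"
  shows "integrable lborel (\<lambda>x. f (x + h))"
  using lborel_integrable_real_affine[OF assms, of 1 h] by (simp add: add.commute)

lemma lborel_integral_shift:
  fixes f :: "real \<Rightarrow> real"
  shows "(LINT x|lborel. f (x + h)) = (LINT x|lborel. f x)"
  using lborel_integral_real_affine[of 1 f h] by (simp add: add.commute)

lemma integral_dominated_tendsto_zero:
  fixes s :: "nat \<Rightarrow> real \<Rightarrow> real"
  assumes "\<And>n. integrable lborel (s n)" "integrable lborel w"
    and "\<And>x. (\<lambda>n. s n x) \<longlonglongrightarrow> 0" "\<And>n x. \<bar>s n x\<bar> \<le> w x"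
  shows "(\<lambda>n. LINT x|lborel. s n x) \<longlonglongrightarrow> 0"
  using integral_dominated_convergence[of "\<lambda>_. 0" lborel s w] assms by simp

definition translation_continuous :: "(real \<Rightarrow> real) \<Rightarrow> bool" where
  "translation_continuous f \<longleftrightarrow>
    (\<forall>h. h \<longlonglongrightarrow> 0 \<longrightarrow> (\<lambda>n::nat. LINT x|lborel. \<bar>f (x + h n) - f x\<bar>) \<longlonglongrightarrow> 0)"

text \<open>Translations are isometries of L1, so continuity of translations survives L1 limits by
  splitting the error into three parts.\<close>

lemma translation_continuous_approx:
  assumes f: "integrable lborel f"
    and approx: "\<And>e. e > 0 \<Longrightarrow> \<exists>g. integrable lborel g \<and> translation_continuous g \<and> (LINT x|lborel. \<bar>f x - g x\<bar>) < e"
  shows "translation_continuous f"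
  unfolding translation_continuous_def
proof (intro allI impI LIMSEQ_I)
  fix h :: "nat \<Rightarrow> real" and e :: real assume h: "h \<longlonglongrightarrow> 0" and e: "0 < e"
  obtain g where g: "integrable lborel g" "translation_continuous g" "(LINT x|lborel. \<bar>f x - g x\<bar>) < e / 3"
    using approx[of "e / 3"] e by auto
  have "(\<lambda>n. LINT x|lborel. \<bar>g (x + h n) - g x\<bar>) \<longlonglongrightarrow> 0"
    using g(2) h unfolding translation_continuous_def by blast
  then obtain n0 where n0: "\<And>n. n \<ge> n0 \<Longrightarrow> \<bar>LINT x|lborel. \<bar>g (x + h n) - g x\<bar>\<bar> < e / 3"
    using LIMSEQ_D[of _ 0 "e / 3"] e by fastforce
  have "norm ((LINT x|lborel. \<bar>f (x + h n) - f x\<bar>) - 0) < e" if n: "n \<ge> n0" for n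
  proof -
    have i1: "integrable lborel (\<lambda>x. \<bar>f x - g x\<bar>)"
      using f g(1) by (intro integrable_abs Bochner_Integration.integrable_diff)
    note i2 = lborel_integrable_shift[OF i1, of "h n"]
    have i3: "integrable lborel (\<lambda>x. \<bar>g (x + h n) - g x\<bar>)"
      using g(1) by (intro integrable_abs Bochner_Integration.integrable_diff lborel_integrable_shift)
    have "(LINT x|lborel. \<bar>f (x + h n) - f x\<bar>) \<le>
        (LINT x|lborel. \<bar>f (x + h n) - g (x + h n)\<bar> + \<bar>g (x + h n) - g x\<bar> + \<bar>f x - g x\<bar>)"
      using i1 i2 i3 f g(1) by (intro integral_mono integrable_abs Bochner_Integration.integrable_diff
          Bochner_Integration.integrable_add lborel_integrable_shift) auto
    also have "\<dots> = (LINT x|lborel. \<bar>f x - g x\<bar>) + (LINT x|lborel. \<bar>g (x + h n) - g x\<bar>) + (LINT x|lborel. \<bar>f x - g x\<bar>)"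
      using i1 i2 i3 lborel_integral_shift[of "\<lambda>x. \<bar>f x - g x\<bar>" "h n"] by simp
    also have "\<dots> < e" using g(3) n0[OF n] by linarith
    finally show ?thesis by (simp add: integral_nonneg_AE)
  qed
  then show "\<exists>no. \<forall>n\<ge>no. norm ((LINT x|lborel. \<bar>f (x + h n) - f x\<bar>) - 0) < e" by blast
qed

text \<open>An open set contains a neighbourhood of each of its points, so the part of \<open>U\<close> that a small
  translation leaves uncovered tends to zero; by translation invariance the other half of the
  symmetric difference has the same measure.\<close>

lemma translation_continuous_open:
  assumes U: "open (U :: real set)" "emeasure lborel U < \<infinity>"
  shows "translation_continuous (indicator U)"
  unfolding translation_continuous_def
proof (intro allI impI)
  fix h :: "nat \<Rightarrow> real" assume h: "h \<longlonglongrightarrow> 0"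
  let ?u = "indicator U :: real \<Rightarrow> real"
  have iU: "integrable lborel ?u" using U by (simp add: borel_open)
  note iUh = lborel_integrable_shift[OF iU]
  have id: "integrable lborel (\<lambda>x. ?u x - ?u (x + h n))" for n
    using iU iUh by (rule Bochner_Integration.integrable_diff)
  have "(\<lambda>n. LINT x|lborel. max 0 (?u x - ?u (x + h n))) \<longlonglongrightarrow> 0"
  proof (rule integral_dominated_tendsto_zero[where w="?u"])
    fix x
    show "(\<lambda>n. max 0 (?u x - ?u (x + h n))) \<longlonglongrightarrow> 0"
    proof (cases "x \<in> U")
      case True
      have "(\<lambda>n. x + h n) \<longlonglongrightarrow> x" using tendsto_add[OF tendsto_const h, of x] by simp
      then have "\<forall>\<^sub>F n in sequentially. x + h n \<in> U" using U(1) True by (rule topological_tendstoD)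
      then have "\<forall>\<^sub>F n in sequentially. max 0 (?u x - ?u (x + h n)) = 0"
        by eventually_elim simp
      then show ?thesis by (rule tendsto_eventually)
    next
      case False
      then show ?thesis by simp
    qed
  qed (use iU id in \<open>auto split: split_indicator\<close>)
  then have "(\<lambda>n. 2 * (LINT x|lborel. max 0 (?u x - ?u (x + h n)))) \<longlonglongrightarrow> 0"
    using tendsto_mult_right_zero by fastforce
  moreover have "(LINT x|lborel. \<bar>?u (x + h n) - ?u x\<bar>) = 2 * (LINT x|lborel. max 0 (?u x - ?u (x + h n)))" for n
  proof -
    have "(LINT x|lborel. \<bar>?u (x + h n) - ?u x\<bar>) = (LINT x|lborel. 2 * max 0 (?u x - ?u (x + h n)) - (?u x - ?u (x + h n)))"
      by (rule Bochner_Integration.integral_cong) (auto split: split_indicator)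
    also have "\<dots> = 2 * (LINT x|lborel. max 0 (?u x - ?u (x + h n))) - (LINT x|lborel. ?u x - ?u (x + h n))"
      using id[of n] by simp
    also have "(LINT x|lborel. ?u x - ?u (x + h n)) = 0"
      using iU iUh[of "h n"] lborel_integral_shift[of ?u "h n"] by simp
    finally show ?thesis by simp
  qed
  ultimately show "(\<lambda>n. LINT x|lborel. \<bar>?u (x + h n) - ?u x\<bar>) \<longlonglongrightarrow> 0" by simp
qed

text \<open>Outer regularity: an open superset \<open>U\<close> of \<open>A\<close> with
  \<open>U - A\<close> of small measure approximates the indicator of \<open>A\<close> in L1, and it
  still has finite measure.\<close>

lemma translation_continuous_indicator:
  assumes A: "A \<in> sets borel" "emeasure lborel (A :: real set) < \<infinity>"
  shows "translation_continuous (indicator A)"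
proof (rule translation_continuous_approx)
  show "integrable lborel (indicator A :: real \<Rightarrow> real)" using A by simp
  fix e :: real assume e: "e > 0"
  obtain U where U: "open U" "A \<subseteq> U" "emeasure lborel (U - A) < ennreal e"
    using outer_regular_lborel[OF A(1) e] by auto
  have bU: "U \<in> sets borel" using U(1) by simp
  have fin: "emeasure lborel (U - A) < \<infinity>" using U(3) by (rule less_trans) simp
  have "emeasure lborel U \<le> emeasure lborel A + emeasure lborel (U - A)"
    using emeasure_subadditive[of A lborel "U - A"] A bU U(2) by (simp add: Un_absorb1)
  also have "\<dots> < \<infinity>" using A(2) fin by simp
  finally have "emeasure lborel U < \<infinity>" .
  moreover have "(LINT x|lborel. \<bar>indicator A x - indicator U x\<bar>) = (LINT x|lborel. indicator (U - A) x :: real)"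
    by (rule Bochner_Integration.integral_cong) (use U(2) in \<open>auto split: split_indicator\<close>)
  moreover have "\<dots> < e"
    using U(3) fin A bU e by (simp add: emeasure_eq_ennreal_measure ennreal_less_iff)
  ultimately show "\<exists>g. integrable lborel g \<and> translation_continuous g \<and> (LINT x|lborel. \<bar>indicator A x - g x\<bar>) < e"
    using translation_continuous_open[OF U(1)] bU by (intro exI[of _ "indicator U"]) auto
qed

lemma translation_continuous_integrable:
  fixes f :: "real \<Rightarrow> real"
  assumes "integrable lborel f"
  shows "translation_continuous f"
  using assms
proof (induction rule: integrable_induct)
  case (base A c)
  then have "translation_continuous (indicator A)" by (intro translation_continuous_indicator) auto
  then show ?case
    unfolding translation_continuous_def
    by (auto simp: abs_mult left_diff_distrib[symmetric] intro!: tendsto_mult_left_zero)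
next
  case (add f g)
  show ?case
    unfolding translation_continuous_def
  proof (intro allI impI)
    fix h :: "nat \<Rightarrow> real" assume "h \<longlonglongrightarrow> 0"
    then have l: "(\<lambda>n. (LINT x|lborel. \<bar>f (x + h n) - f x\<bar>) + (LINT x|lborel. \<bar>g (x + h n) - g x\<bar>)) \<longlonglongrightarrow> 0"
      using add unfolding translation_continuous_def by (auto intro!: tendsto_add_zero)
    have sh: "integrable lborel (\<lambda>x. f (x + h n))" "integrable lborel (\<lambda>x. g (x + h n))" for n
      using add by (auto intro!: lborel_integrable_shift)
    have i: "integrable lborel (\<lambda>x. \<bar>f (x + h n) - f x\<bar>)" "integrable lborel (\<lambda>x. \<bar>g (x + h n) - g x\<bar>)" for n
      using add sh by auto
    have "(LINT x|lborel. \<bar>(f (x + h n) + g (x + h n)) - (f x + g x)\<bar>) \<le>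
        (LINT x|lborel. \<bar>f (x + h n) - f x\<bar> + \<bar>g (x + h n) - g x\<bar>)" for n
      using add i sh by (intro integral_mono) auto
    then show "(\<lambda>n. LINT x|lborel. \<bar>(f (x + h n) + g (x + h n)) - (f x + g x)\<bar>) \<longlonglongrightarrow> 0"
      using i by (intro Lim_null_comparison[OF _ l]) (simp add: integral_nonneg_AE)
  qed
next
  case (lim f s)
  show ?case
  proof (rule translation_continuous_approx[OF \<open>integrable lborel f\<close>])
    fix e :: real assume e: "e > 0"
    have "(\<lambda>i. LINT x|lborel. \<bar>f x - s i x\<bar>) \<longlonglongrightarrow> 0"
    \<comment> \<open>The approximations in the induction rule are bounded by twice \<bar>f\<bar>,
      hence the factor 3.\<close>
    proof (rule integral_dominated_tendsto_zero[where w="\<lambda>x. 3 * \<bar>f x\<bar>"])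
      have "(\<lambda>i. \<bar>f x - s i x\<bar>) \<longlonglongrightarrow> \<bar>f x - f x\<bar>" for x
        using lim by (intro tendsto_intros) auto
      then show "(\<lambda>i. \<bar>f x - s i x\<bar>) \<longlonglongrightarrow> 0" for x by simp
      have b: "\<bar>s i x\<bar> \<le> 2 * \<bar>f x\<bar>" for i x using lim by simp
      have "\<bar>f x - s i x\<bar> \<le> 3 * \<bar>f x\<bar>" for i x
        using b[of i x] by linarith
      then show "\<bar>\<bar>f x - s i x\<bar>\<bar> \<le> 3 * \<bar>f x\<bar>" for i x by simp
    qed (use lim in auto)
    then obtain i where "\<bar>LINT x|lborel. \<bar>f x - s i x\<bar>\<bar> < e"
      using LIMSEQ_D[of _ 0 e] e by fastforce
    then show "\<exists>g. integrable lborel g \<and> translation_continuous g \<and> (LINT x|lborel. \<bar>f x - g x\<bar>) < e"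
      using lim by (intro exI[of _ "s i"]) auto
  qed
qed

text \<open>A change of time alters the factor \<open>E\<close> at a fixed label, which is handled
  by dominated convergence, and translates a fixed integrable function, which is handled by
  continuity of translations. The profile \<open>g\<close> need not be integrable towards minus
  infinity; up to time \<open>T\<close>, nonnegative seniorities see only labels from
  \<open>- T\<close> on, so \<open>g\<close> may be cut off there.\<close>

lemma continuous_into_L1_transport:
  fixes g :: "real \<Rightarrow> real" and E :: "real \<Rightarrow> real \<Rightarrow> real"
  assumes g: "\<And>T. integrable lborel (\<lambda>x. g x * indicator {- T..} x)"
    and E: "\<And>t. E t \<in> borel_measurable borel" "\<And>t x. \<bar>E t x\<bar> \<le> 1"
    and cE: "\<And>x. continuous_on {0..} (\<lambda>t. E t x)"
  shows "continuous_into_L1 (\<lambda>t s. g (s - t) * E t (s - t))"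
  unfolding continuous_into_L1_def
proof (intro conjI allI impI)
  define G where "G = (\<lambda>T x. g x * indicator {- T..} x)"
  have G: "integrable lborel (G T)" for T unfolding G_def by (rule g)
  have F: "integrable lborel (\<lambda>x. G T x * E t x)" for T t
    using set_integrable_mult_bounded[of UNIV "G T" "E t" 1] G E by (simp add: set_integrable_def)
  fix t :: real assume t: "0 \<le> t"
  have GE: "indicator {0..} s *\<^sub>R (g (s - u) * E u (s - u)) = indicator {0..} s *\<^sub>R (G T (s - u) * E u (s - u))" if "u \<le> T" for u T s
    using that by (auto simp: G_def split: split_indicator)
  have int: "set_integrable lborel {0..} (\<lambda>s. g (s - u) * E u (s - u))" for u
    unfolding set_integrable_def GE[OF order_refl] using lborel_integrable_shift[OF F[of u u], of "- u"]
    by (intro integrable_mult_indicator) auto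
  then show "set_integrable lborel {0..} (\<lambda>s. g (s - t) * E t (s - t))" .
  show "((\<lambda>u. LINT s:{0..}|lborel. \<bar>g (s - u) * E u (s - u) - g (s - t) * E t (s - t)\<bar>) \<longlongrightarrow> 0) (at t within {0..})"
    unfolding tendsto_at_iff_sequentially o_def
  proof (intro allI impI)
    fix u assume u: "\<forall>i. u i \<in> {0..} - {t}" and lim: "u \<longlonglongrightarrow> t"
    have "Bseq u" using lim by (intro convergent_imp_Bseq convergentI)
    then obtain T where "\<And>n. \<bar>u n\<bar> \<le> T" by (auto simp: Bseq_def)
    then have T: "u n \<le> T" for n by (meson abs_le_D1)
    have tT: "t \<le> T" using lim T by (intro LIMSEQ_le_const2) auto
    let ?G = "G T"
    let ?F = "\<lambda>x. ?G x * E t x"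
    let ?V = "\<lambda>n x. ?G x * (E (u n) x - E t x)"
    have V: "integrable lborel (?V n)" for n
      using Bochner_Integration.integrable_diff[OF F F, of T "u n" T t] by (simp add: right_diff_distrib)
    have 1: "(\<lambda>n. LINT x|lborel. \<bar>?V n x\<bar>) \<longlonglongrightarrow> 0"
    proof (rule integral_dominated_tendsto_zero[where w="\<lambda>x. 2 * \<bar>?G x\<bar>"])
      show "(\<lambda>n. \<bar>?V n x\<bar>) \<longlonglongrightarrow> 0" for x
      proof -
        have "(\<lambda>n. E (u n) x) \<longlonglongrightarrow> E t x"
          using cE[of x] u lim t unfolding continuous_on_sequentially by (auto simp: o_def)
        then have "(\<lambda>n. \<bar>?V n x\<bar>) \<longlonglongrightarrow> \<bar>?G x * (E t x - E t x)\<bar>" by (intro tendsto_intros)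
        then show "(\<lambda>n. \<bar>?V n x\<bar>) \<longlonglongrightarrow> 0" by simp
      qed
      have "\<bar>E (u n) x - E t x\<bar> \<le> 2" for n x using E(2)[of "u n" x] E(2)[of t x] by linarith
      then have "\<bar>?G x\<bar> * \<bar>E (u n) x - E t x\<bar> \<le> \<bar>?G x\<bar> * 2" for n x
        by (intro mult_left_mono) auto
      then show "\<bar>\<bar>?V n x\<bar>\<bar> \<le> 2 * \<bar>?G x\<bar>" for n x
        by (simp add: abs_mult mult.commute)
    qed (use G V in auto)
    have "(\<lambda>n. t - u n) \<longlonglongrightarrow> t - t" by (intro tendsto_intros lim)
    then have 2: "(\<lambda>n. LINT x|lborel. \<bar>?F (x + (t - u n)) - ?F x\<bar>) \<longlonglongrightarrow> 0"
      using translation_continuous_integrable[OF F] unfolding translation_continuous_def by simp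
    have sum: "(\<lambda>n. (LINT x|lborel. \<bar>?V n x\<bar>) + (LINT x|lborel. \<bar>?F (x + (t - u n)) - ?F x\<bar>)) \<longlonglongrightarrow> 0"
      using tendsto_add[OF 1 2] by simp
    show "(\<lambda>n. LINT s:{0..}|lborel. \<bar>g (s - u n) * E (u n) (s - u n) - g (s - t) * E t (s - t)\<bar>) \<longlonglongrightarrow> 0"
    proof (rule Lim_null_comparison[OF _ sum], intro always_eventually allI)
      fix n
      let ?I = "LINT s:{0..}|lborel. \<bar>g (s - u n) * E (u n) (s - u n) - g (s - t) * E t (s - t)\<bar>"
      have V': "integrable lborel (\<lambda>s. \<bar>?V n (s + - u n)\<bar>)"
        using V by (intro integrable_abs lborel_integrable_shift)
      have F': "integrable lborel (\<lambda>s. \<bar>?F (s + - u n) - ?F (s + - t)\<bar>)"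
        by (intro integrable_abs Bochner_Integration.integrable_diff
            lborel_integrable_shift[OF F[of T t], of "- u n"] lborel_integrable_shift[OF F[of T t], of "- t"])
      have "?I \<le> (LINT s|lborel. \<bar>?V n (s + - u n)\<bar> + \<bar>?F (s + - u n) - ?F (s + - t)\<bar>)"
        unfolding set_lebesgue_integral_def
      proof (rule integral_mono)
        show "integrable lborel (\<lambda>s. indicator {0..} s *\<^sub>R \<bar>g (s - u n) * E (u n) (s - u n) - g (s - t) * E t (s - t)\<bar>)"
          using set_integral_diff(1)[OF int int] set_integrable_abs unfolding set_integrable_def[symmetric] by blast
        show "indicator {0..} s *\<^sub>R \<bar>g (s - u n) * E (u n) (s - u n) - g (s - t) * E t (s - t)\<bar>
            \<le> \<bar>?V n (s + - u n)\<bar> + \<bar>?F (s + - u n) - ?F (s + - t)\<bar>" for s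
        proof (cases "s \<ge> 0")
          case True
          then have "g (s - u n) = ?G (s - u n)" "g (s - t) = ?G (s - t)"
            using T[of n] tT by (auto simp: G_def)
          then have "g (s - u n) * E (u n) (s - u n) - g (s - t) * E t (s - t) = ?V n (s + - u n) + (?F (s + - u n) - ?F (s + - t))"
            by (simp add: algebra_simps)
          then show ?thesis using True abs_triangle_ineq by simp
        qed simp
      qed (use V' F' in auto)
      also have "\<dots> = (LINT s|lborel. \<bar>?V n (s + - u n)\<bar>) + (LINT s|lborel. \<bar>?F (s + - u n) - ?F (s + - t)\<bar>)"
        by (rule Bochner_Integration.integral_add[OF V' F'])
      also have "(LINT s|lborel. \<bar>?V n (s + - u n)\<bar>) = (LINT x|lborel. \<bar>?V n x\<bar>)"
        by (rule lborel_integral_shift)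
      also have "(LINT s|lborel. \<bar>?F (s + - u n) - ?F (s + - t)\<bar>) = (LINT x|lborel. \<bar>?F (x + (t - u n)) - ?F x\<bar>)"
        using lborel_integral_shift[of "\<lambda>x. \<bar>?F (x + (t - u n)) - ?F x\<bar>" "- t"] by simp
      finally have "?I \<le> (LINT x|lborel. \<bar>?V n x\<bar>) + (LINT x|lborel. \<bar>?F (x + (t - u n)) - ?F x\<bar>)" .
      moreover have "0 \<le> ?I"
        unfolding set_lebesgue_integral_def by (intro integral_nonneg_AE) auto
      ultimately show "norm ?I \<le> (LINT x|lborel. \<bar>?V n x\<bar>) + (LINT x|lborel. \<bar>?F (x + (t - u n)) - ?F x\<bar>)"
        by simp
    qed
  qed
qed

section \<open>Test functions along characteristics\<close>

text \<open>Derivatives within an interval to the right of \<open>t\<close> are unique, and there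
  \<open>f\<close> vanishes. This covers the one-sided derivatives on the boundary of the
  quadrant.\<close>

lemma DERIV_zero_if_locally_zero:
  fixes f :: "real \<Rightarrow> real"
  assumes "(f has_real_derivative D) (at t within {0..})" "t \<ge> 0" "\<And>u. u \<ge> t \<Longrightarrow> f u = 0"
  shows "D = 0"
proof -
  have 1: "(f has_vector_derivative D) (at t within cbox t (t + 1))"
    using assms(1,2) by (auto simp: has_real_derivative_iff_has_vector_derivative intro: has_vector_derivative_within_subset)
  have 2: "(f has_vector_derivative 0) (at t within cbox t (t + 1))"
    by (rule has_vector_derivative_transform[of _ _ _ "\<lambda>_. 0"]) (use assms(3) in auto)
  show ?thesis
    by (rule vector_derivative_unique_within_closed_interval[OF _ _ 1 2]) auto
qed

lemma test_function_support:
  assumes "test_function \<phi> \<phi>\<^sub>t \<phi>\<^sub>s"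
  obtains R where "R > 0"
    "\<And>t s. t \<ge> 0 \<Longrightarrow> s \<ge> 0 \<Longrightarrow> t > R \<or> s > R \<Longrightarrow> \<phi> t s = 0 \<and> \<phi>\<^sub>t t s = 0 \<and> \<phi>\<^sub>s t s = 0"
proof -
  obtain R where R: "\<And>t s. t \<ge> 0 \<Longrightarrow> s \<ge> 0 \<Longrightarrow> t > R \<or> s > R \<Longrightarrow> \<phi> t s = 0"
    using assms unfolding test_function_def by blast
  show thesis
  proof (rule that[of "max R 1"])
    fix t s :: real assume ts: "t \<ge> 0" "s \<ge> 0" "t > max R 1 \<or> s > max R 1"
    have d: "((\<lambda>u. \<phi> u s) has_real_derivative \<phi>\<^sub>t t s) (at t within {0..})"
      "((\<lambda>u. \<phi> t u) has_real_derivative \<phi>\<^sub>s t s) (at s within {0..})"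
      using assms ts unfolding test_function_def by blast+
    have "\<phi>\<^sub>t t s = 0"
      by (rule DERIV_zero_if_locally_zero[OF d(1) ts(1)], rule R) (use ts in linarith)+
    moreover have "\<phi>\<^sub>s t s = 0"
      by (rule DERIV_zero_if_locally_zero[OF d(2) ts(2)], rule R) (use ts in linarith)+
    ultimately show "\<phi> t s = 0 \<and> \<phi>\<^sub>t t s = 0 \<and> \<phi>\<^sub>s t s = 0" using R ts by auto
  qed auto
qed

text \<open>Test functions come with partial derivatives only. Differentiation along a
  characteristic moves both variables and needs the total derivative, which continuity of a partial
  derivative provides, also on the boundary.\<close>

lemma test_function_has_derivative:
  assumes tf: "test_function \<phi> \<phi>\<^sub>t \<phi>\<^sub>s" and "t \<ge> 0" "s \<ge> 0"
  shows "((\<lambda>(t, s). \<phi> t s) has_derivative (\<lambda>(h, k). \<phi>\<^sub>t t s * h + \<phi>\<^sub>s t s * k)) (at (t, s) within {0..} \<times> {0..})"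
proof -
  have "((\<lambda>(t, s). \<phi> t s) has_derivative
      (\<lambda>(h, k). \<phi>\<^sub>t t s * h + blinfun_apply (blinfun_mult_right (\<phi>\<^sub>s t s)) k)) (at (t, s) within {0..} \<times> {0..})"
  proof (rule has_derivative_partialsI[where fy="\<lambda>t s. blinfun_mult_right (\<phi>\<^sub>s t s)"])
    show "((\<lambda>t. \<phi> t s) has_derivative (*) (\<phi>\<^sub>t t s)) (at t within {0..})"
      using tf assms(2,3) unfolding test_function_def has_field_derivative_def by blast
    show "((\<lambda>s. \<phi> t s) has_derivative blinfun_apply (blinfun_mult_right (\<phi>\<^sub>s t s))) (at s within {0..})"
      if "t \<in> {0..}" "s \<in> {0..}" for t s
      using tf that unfolding test_function_def has_field_derivative_def
      by (auto simp: blinfun_mult_right.rep_eq)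
    have "continuous_on ({0..} \<times> {0..}) (\<lambda>p. blinfun_mult_right (case p of (t, s) \<Rightarrow> \<phi>\<^sub>s t s))"
      using tf unfolding test_function_def
      by (intro bounded_linear.continuous_on[OF bounded_linear_blinfun_mult_right]) blast
    then show "continuous (at (t, s) within {0..} \<times> {0..}) (\<lambda>(t, s). blinfun_mult_right (\<phi>\<^sub>s t s))"
      using assms(2,3) by (auto simp: continuous_on_eq_continuous_within case_prod_unfold)
  qed (use assms in auto)
  then show ?thesis by (simp add: blinfun_mult_right.rep_eq)
qed

lemma test_function_continuous:
  assumes "test_function \<phi> \<phi>\<^sub>t \<phi>\<^sub>s"
  shows "continuous_on ({0..} \<times> {0..}) (\<lambda>(t, s). \<phi> t s)"
  unfolding continuous_on_eq_continuous_within
proof clarify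
  fix t s :: real assume "0 \<le> t" "0 \<le> s"
  then show "continuous (at (t, s) within {0..} \<times> {0..}) (\<lambda>(t, s). \<phi> t s)"
    by (intro has_derivative_continuous[OF test_function_has_derivative[OF assms]]) auto
qed

text \<open>The chain rule on the path through label \<open>x\<close>. After the entry time
  \<open>max 0 (- x)\<close> the path is inside the quadrant on both sides of \<open>t\<close>, so
  the derivative is two-sided.\<close>

lemma test_function_characteristic_derivative:
  assumes tf: "test_function \<phi> \<phi>\<^sub>t \<phi>\<^sub>s" and t: "t > max 0 (- x)"
  shows "((\<lambda>u. \<phi> u (u + x)) has_real_derivative \<phi>\<^sub>t t (t + x) + \<phi>\<^sub>s t (t + x)) (at t)"
proof -
  let ?S = "{max 0 (- x)<..}"
  have "((\<lambda>u. (u, u + x)) has_derivative (\<lambda>h. (h, h))) (at t within ?S)"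
    by (auto intro!: derivative_eq_intros)
  moreover have "((\<lambda>(t, s). \<phi> t s) has_derivative (\<lambda>(h, k). \<phi>\<^sub>t t (t + x) * h + \<phi>\<^sub>s t (t + x) * k))
      (at (t, t + x) within (\<lambda>u. (u, u + x)) ` ?S)"
    by (rule has_derivative_subset[OF test_function_has_derivative[OF tf]]) (use t in auto)
  ultimately have "((\<lambda>u. case (u, u + x) of (t, s) \<Rightarrow> \<phi> t s) has_derivative
      (\<lambda>h. case (h, h) of (h, k) \<Rightarrow> \<phi>\<^sub>t t (t + x) * h + \<phi>\<^sub>s t (t + x) * k)) (at t within ?S)"
    by (rule has_derivative_in_compose)
  moreover have "at t within ?S = at t" using t by (intro at_within_open) auto
  moreover have "(*) (\<phi>\<^sub>t t (t + x) + \<phi>\<^sub>s t (t + x)) = (\<lambda>h. \<phi>\<^sub>t t (t + x) * h + \<phi>\<^sub>s t (t + x) * h)"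
    by (rule ext) (rule distrib_right)
  ultimately show ?thesis
    unfolding has_field_derivative_def by simp
qed

section \<open>Bounds and product integrability\<close>

lemma compactly_supported_bounded:
  fixes f :: "real \<Rightarrow> real \<Rightarrow> real"
  assumes "continuous_on ({0..} \<times> {0..}) (\<lambda>(t, s). f t s)"
    and "\<And>t s. t \<ge> 0 \<Longrightarrow> s \<ge> 0 \<Longrightarrow> t > R \<or> s > R \<Longrightarrow> f t s = 0"
  obtains B where "B \<ge> 0" "\<And>t s. t \<ge> 0 \<Longrightarrow> s \<ge> 0 \<Longrightarrow> \<bar>f t s\<bar> \<le> B"
proof -
  have "compact ((\<lambda>(t, s). f t s) ` ({0..R} \<times> {0..R}))"
    by (intro compact_continuous_image continuous_on_subset[OF assms(1)] compact_Times) auto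
  then obtain B where B: "B > 0" "\<And>p. p \<in> {0..R} \<times> {0..R} \<Longrightarrow> \<bar>case p of (t, s) \<Rightarrow> f t s\<bar> \<le> B"
    by (metis (no_types, lifting) bounded_pos compact_imp_bounded image_eqI real_norm_def)
  have "\<bar>f t s\<bar> \<le> B" if "t \<ge> 0" "s \<ge> 0" for t s
  proof (cases "t > R \<or> s > R")
    case True
    then show ?thesis using assms(2)[OF that] B(1) by simp
  next
    case False
    then show ?thesis using B(2)[of "(t, s)"] that by auto
  qed
  then show thesis using that[of B] B(1) by simp
qed

lemma integrable_lborel_prod_mult:
  fixes u v :: "real \<Rightarrow> real"
  assumes u: "integrable lborel u" and v: "integrable lborel v"
  shows "integrable (lborel \<Otimes>\<^sub>M lborel) (\<lambda>(t, x). u t * v x)"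
proof (rule lborel_pair.Fubini_integrable)
  have [measurable]: "u \<in> borel_measurable borel" "v \<in> borel_measurable borel"
    using u v by auto
  show "(\<lambda>(t, x). u t * v x) \<in> borel_measurable (lborel \<Otimes>\<^sub>M lborel)" by measurable
  have "(\<lambda>t. LINT x|lborel. norm (case (t, x) of (t, x) \<Rightarrow> u t * v x)) = (\<lambda>t. \<bar>u t\<bar> * (LINT x|lborel. \<bar>v x\<bar>))"
    by (simp add: abs_mult)
  then show "integrable lborel (\<lambda>t. LINT x|lborel. norm (case (t, x) of (t, x) \<Rightarrow> u t * v x))"
    using u by simp
  show "AE t in lborel. integrable lborel (\<lambda>x. case (t, x) of (t, x) \<Rightarrow> u t * v x)"
    using v by simp
qed

section \<open>The explicit solution\<close>

lemma integrable_indicator_Icc: "integrable lborel (indicator {x..y} :: real \<Rightarrow> real)"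
  by (rule integrable_real_indicator) (auto simp: emeasure_lborel_Icc_eq)

text \<open>The explicit solution in the characteristic coordinate \<open>x = s - t\<close>. The factor \<open>decay t x\<close>
  is the fraction of workers with label \<open>x\<close> still present at time \<open>t\<close>: they entered at time
  \<open>max 0 (- x)\<close> and are subject to promotion from time \<open>max 0 (\<tau> - x)\<close> on.\<close>

locale linear_transport =
  fixes \<mu> \<tau> b :: real and \<rho>\<^sub>0 a H :: "real \<Rightarrow> real"
  assumes \<tau>: "\<tau> \<ge> 0" and \<mu>: "\<mu> > 0"
    and \<rho>0: "set_integrable lborel {0..} \<rho>\<^sub>0"
    and a_nonneg: "\<And>t. a t \<ge> 0" and a_cont: "continuous_on UNIV a"
    and H: "\<And>t. (H has_real_derivative a t) (at t)"
begin

text \<open>The density a label carries when it starts: a label \<open>x < 0\<close> enters at time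
  \<open>- x\<close> with the inflow, a label \<open>x \<ge> 0\<close> is present at time 0 with
  seniority \<open>x\<close>.\<close>

definition source :: "real \<Rightarrow> real" where
  "source x = (if x < 0 then b else \<rho>\<^sub>0 x)"

definition decay :: "real \<Rightarrow> real \<Rightarrow> real" where
  "decay t x = exp (- \<mu> * (t - min t (max 0 (- x))) - (H t - H (min t (max 0 (\<tau> - x)))))"

definition solution :: "real \<Rightarrow> real \<Rightarrow> real" where
  "solution t s = source (s - t) * decay t (s - t)"

lemma source_altdef: "source x = b * indicator {..<0} x + indicator {0..} x *\<^sub>R \<rho>\<^sub>0 x"
  by (simp add: source_def)

lemma source_measurable [measurable]: "source \<in> borel_measurable borel"
proof -
  have [measurable]: "(\<lambda>x. indicator {0..} x *\<^sub>R \<rho>\<^sub>0 x) \<in> borel_measurable borel"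
    using \<rho>0 by (auto simp: set_integrable_def)
  show ?thesis unfolding source_altdef[abs_def] by measurable
qed

lemma source_integrable:
  "integrable lborel (\<lambda>x. source x * indicator {- T..} x)"
proof (rule Bochner_Integration.integrable_bound)
  show "integrable lborel (\<lambda>x. \<bar>b\<bar> * indicator {- T..0} x + indicator {0..} x *\<^sub>R \<bar>\<rho>\<^sub>0 x\<bar>)"
    using set_integrable_abs[OF \<rho>0] unfolding set_integrable_def
    by (intro Bochner_Integration.integrable_add integrable_mult_right integrable_indicator_Icc) auto
  show "AE x in lborel. norm (source x * indicator {- T..} x)
      \<le> norm (\<bar>b\<bar> * indicator {- T..0} x + indicator {0..} x *\<^sub>R \<bar>\<rho>\<^sub>0 x\<bar>)"
    by (auto simp: source_def split: split_indicator)
qed measurable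

lemma H_continuous: "continuous_on UNIV H"
  using H by (intro DERIV_continuous_on) auto

lemma H_measurable [measurable]: "H \<in> borel_measurable borel"
  by (rule borel_measurable_continuous_onI[OF H_continuous])

lemma H_mono: "x \<le> y \<Longrightarrow> H x \<le> H y"
  using H a_nonneg by (intro DERIV_nonneg_imp_nondecreasing[of x y H]) auto

lemma decay_measurable [measurable]:
  "(\<lambda>(t, x). decay t x) \<in> borel_measurable (borel \<Otimes>\<^sub>M borel)"
  unfolding decay_def[abs_def] by measurable

text \<open>Clamping with \<open>min t\<close> makes both parts of the exponent nonpositive even for
  labels that have not yet entered or are not yet eligible, so the bound holds for all
  \<open>t\<close> and \<open>x\<close>.\<close>

lemma decay_bound: "\<bar>decay t x\<bar> \<le> 1"
proof -
  have "0 \<le> \<mu> * (t - min t (max 0 (- x)))" using \<mu> by (intro mult_nonneg_nonneg) auto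
  moreover have "H (min t (max 0 (\<tau> - x))) \<le> H t" by (rule H_mono) simp
  ultimately show ?thesis by (simp add: decay_def)
qed

lemma decay_continuous: "continuous_on A (\<lambda>t. decay t x)"
  unfolding decay_def
  by (intro continuous_intros continuous_on_compose2[OF H_continuous]) auto

lemma decay_start: "decay (max 0 (- x)) x = 1"
proof -
  have "min (max 0 (- x)) (max 0 (\<tau> - x)) = max 0 (- x)" using \<tau> by auto
  then show ?thesis by (simp add: decay_def)
qed

text \<open>The rate jumps when the label reaches seniority \<open>\<tau>\<close>, at
  \<open>t = \<tau> - x\<close>, where the decay factor may have a kink. On either side one of the
  two clamped formulas is smooth.\<close>

lemma decay_derivative:
  assumes t: "t > max 0 (- x)" "t \<noteq> \<tau> - x"
  shows "((\<lambda>t. decay t x) has_real_derivative - (\<mu> + a t * indicator {\<tau>..} (t + x)) * decay t x) (at t)"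
proof (cases "t < \<tau> - x")
  case True
  have d: "((\<lambda>t. exp (- \<mu> * (t - max 0 (- x)))) has_real_derivative - \<mu> * exp (- \<mu> * (t - max 0 (- x)))) (at t)"
    by (auto intro!: derivative_eq_intros)
  have eq: "exp (- \<mu> * (u - max 0 (- x))) = decay u x" if "u \<in> {max 0 (- x)<..<\<tau> - x}" for u
  proof -
    have "min u (max 0 (- x)) = max 0 (- x)" "min u (max 0 (\<tau> - x)) = u" using that by auto
    then show ?thesis by (simp add: decay_def)
  qed
  have "((\<lambda>t. decay t x) has_real_derivative - \<mu> * exp (- \<mu> * (t - max 0 (- x)))) (at t)"
    by (rule has_field_derivative_transform_within_open[where S="{max 0 (- x)<..<\<tau> - x}", OF d _ _ eq]) (use True t in auto)
  then show ?thesis using eq[of t] True t by simp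
next
  case False
  then have gt: "t > max 0 (\<tau> - x)" using t by auto
  let ?F = "\<lambda>t. exp (- \<mu> * (t - max 0 (- x)) - (H t - H (max 0 (\<tau> - x))))"
  have d: "(?F has_real_derivative - (\<mu> + a t) * ?F t) (at t)"
    by (rule derivative_eq_intros H refl)+ (simp add: algebra_simps)
  have eq: "?F u = decay u x" if "u \<in> {max 0 (\<tau> - x)<..}" for u
  proof -
    have "min u (max 0 (- x)) = max 0 (- x)" "min u (max 0 (\<tau> - x)) = max 0 (\<tau> - x)" using that \<tau> by auto
    then show ?thesis by (simp add: decay_def)
  qed
  have "((\<lambda>t. decay t x) has_real_derivative - (\<mu> + a t) * ?F t) (at t)"
    by (rule has_field_derivative_transform_within_open[where S="{max 0 (\<tau> - x)<..}", OF d _ _ eq]) (use gt in auto)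
  then show ?thesis using eq[of t] gt by simp
qed

lemma solution_continuous_into_L1: "continuous_into_L1 solution"
proof -
  have "continuous_into_L1 (\<lambda>t s. source (s - t) * decay t (s - t))"
  proof (rule continuous_into_L1_transport[OF source_integrable _ decay_bound decay_continuous])
    show "decay t \<in> borel_measurable borel" for t
      unfolding decay_def[abs_def] by measurable
  qed
  then show ?thesis unfolding solution_def[abs_def] .
qed

text \<open>In label coordinates Fubini's theorem lets time be integrated at a fixed label. There
  the integrand is the derivative of decay times test function, and only minus the value at the
  starting point survives. Starting points are (0, x) for \<open>x \<ge> 0\<close> and (-x, 0) for
  \<open>x < 0\<close>, which give the initial term and the inflow term.\<close>

theorem solution_weak: "linear_weak_solution \<mu> \<tau> a b \<rho>\<^sub>0 solution"
  unfolding linear_weak_solution_def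
proof (intro conjI solution_continuous_into_L1 allI impI)
  fix \<phi> \<phi>\<^sub>t \<phi>\<^sub>s assume tf: "test_function \<phi> \<phi>\<^sub>t \<phi>\<^sub>s"
  obtain R where R: "R > 0"
    "\<And>t s. t \<ge> 0 \<Longrightarrow> s \<ge> 0 \<Longrightarrow> t > R \<or> s > R \<Longrightarrow> \<phi> t s = 0 \<and> \<phi>\<^sub>t t s = 0 \<and> \<phi>\<^sub>s t s = 0"
    using test_function_support[OF tf] by blast
  note c = test_function_continuous[OF tf]
  have ct: "continuous_on ({0..} \<times> {0..}) (\<lambda>(t, s). \<phi>\<^sub>t t s)"
    and cs: "continuous_on ({0..} \<times> {0..}) (\<lambda>(t, s). \<phi>\<^sub>s t s)"
    using tf unfolding test_function_def by blast+
  define Q :: "(real \<times> real) set" where "Q = {0..} \<times> {0..}"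
  define D where "D = (\<lambda>t s. \<phi>\<^sub>t t s + \<phi>\<^sub>s t s - \<mu> * \<phi> t s - a t * indicator {\<tau>..} s * \<phi> t s)"
  \<comment> \<open>Extension by zero outside the quadrant removes all constraints on
    \<open>t\<close> and \<open>x\<close> after the substitution \<open>s = t + x\<close>.\<close>
  define L where "L = (\<lambda>t s. indicator Q (t, s) * D t s)"
  have L_eq: "L t s = D t s" if "t \<ge> 0" "s \<ge> 0" for t s
    using that by (simp add: L_def Q_def)
  have L_0: "L t s = 0" if "t < 0 \<or> s < 0 \<or> t > R \<or> s > R" for t s
    using that R(2)[of t s] by (cases "(t, s) \<in> Q") (auto simp: L_def D_def Q_def)
  have [measurable]: "a \<in> borel_measurable borel"
    by (rule borel_measurable_continuous_onI[OF a_cont])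
  have Q: "Q \<in> sets borel" unfolding Q_def by (intro borel_closed closed_Times) auto
  have m: "(\<lambda>p. indicator Q p *\<^sub>R (case p of (t, s) \<Rightarrow> f t s)) \<in> borel_measurable (borel \<Otimes>\<^sub>M borel)"
    if "continuous_on ({0..} \<times> {0..}) (\<lambda>(t, s). f t s)" for f :: "real \<Rightarrow> real \<Rightarrow> real"
    using borel_measurable_continuous_on_indicator[OF Q, of "\<lambda>(t, s). f t s"] that
    by (simp add: borel_prod Q_def)
  note [measurable] = m[OF c] m[OF ct] m[OF cs]
  have L_alt: "(\<lambda>(t, s). L t s) = (\<lambda>p. indicator Q p *\<^sub>R (case p of (t, s) \<Rightarrow> \<phi>\<^sub>t t s)
      + indicator Q p *\<^sub>R (case p of (t, s) \<Rightarrow> \<phi>\<^sub>s t s) - \<mu> * (indicator Q p *\<^sub>R (case p of (t, s) \<Rightarrow> \<phi> t s))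
      - a (fst p) * indicator {\<tau>..} (snd p) * (indicator Q p *\<^sub>R (case p of (t, s) \<Rightarrow> \<phi> t s)))"
    by (auto simp: fun_eq_iff L_def D_def algebra_simps)
  have L_meas [measurable]: "(\<lambda>(t, s). L t s) \<in> borel_measurable (borel \<Otimes>\<^sub>M borel)"
    unfolding L_alt by measurable
  obtain B where B: "B \<ge> 0" "\<And>t s. t \<ge> 0 \<Longrightarrow> s \<ge> 0 \<Longrightarrow> \<bar>\<phi> t s\<bar> \<le> B"
    using compactly_supported_bounded[OF c, of R] R by metis
  obtain Bt where Bt: "Bt \<ge> 0" "\<And>t s. t \<ge> 0 \<Longrightarrow> s \<ge> 0 \<Longrightarrow> \<bar>\<phi>\<^sub>t t s\<bar> \<le> Bt"
    using compactly_supported_bounded[OF ct, of R] R by metis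
  obtain Bs where Bs: "Bs \<ge> 0" "\<And>t s. t \<ge> 0 \<Longrightarrow> s \<ge> 0 \<Longrightarrow> \<bar>\<phi>\<^sub>s t s\<bar> \<le> Bs"
    using compactly_supported_bounded[OF cs, of R] R by metis
  obtain K where K: "K > 0" "\<And>t. 0 \<le> t \<Longrightarrow> t \<le> R \<Longrightarrow> \<bar>a t\<bar> \<le> K"
    using continuous_on_bounded_Icc[OF continuous_on_subset[OF a_cont]] by (metis subset_UNIV)
  define C where "C = Bt + Bs + \<mu> * B + K * B"
  have C: "C \<ge> 0" unfolding C_def using Bt(1) Bs(1) B(1) K(1) \<mu> by (intro add_nonneg_nonneg mult_nonneg_nonneg) auto
  have L_bound: "\<bar>L t s\<bar> \<le> C * (indicator {0..R} t * indicator {0..R} s)" for t s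
  proof (cases "t \<in> {0..R} \<and> s \<in> {0..R}")
    case True
    then have ts: "t \<ge> 0" "s \<ge> 0" "t \<le> R" by auto
    have "\<bar>\<mu> * \<phi> t s\<bar> \<le> \<mu> * B" using B(2)[OF ts(1,2)] \<mu> by (simp add: abs_mult)
    moreover have "\<bar>a t * indicator {\<tau>..} s * \<phi> t s\<bar> \<le> K * B"
    proof -
      have "\<bar>a t * indicator {\<tau>..} s\<bar> \<le> K" using K(2)[OF ts(1,3)] K(1) by (auto split: split_indicator)
      then show ?thesis
        unfolding abs_mult[of "a t * indicator {\<tau>..} s"] using B(2)[OF ts(1,2)] K(1) by (intro mult_mono) auto
    qed
    ultimately have "\<bar>D t s\<bar> \<le> C"
      unfolding D_def C_def using Bt(2)[OF ts(1,2)] Bs(2)[OF ts(1,2)] by linarith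
    then show ?thesis using True ts L_eq by simp
  next
    case False
    then show ?thesis using L_0[of t s] C by (auto simp: not_le)
  qed
  define J where "J = (\<lambda>t x. source x * (decay t x * L t (t + x)))"
  have J_int: "integrable (lborel \<Otimes>\<^sub>M lborel) (case_prod J)"
  proof (rule Bochner_Integration.integrable_bound)
    \<comment> \<open>\<open>L\<close> lives on the square of side \<open>R\<close>, so only labels
      between \<open>- R\<close> and \<open>R\<close> contribute; \<open>source\<close> is
      integrable there.\<close>
    have "integrable lborel (\<lambda>x. indicator {..R} x *\<^sub>R (source x * indicator {- R..} x))"
      using source_integrable[of R] by (intro integrable_mult_indicator) auto
    then show "integrable (lborel \<Otimes>\<^sub>M lborel)
        (\<lambda>(t, x). (C * indicator {0..R} t) * (indicator {..R} x *\<^sub>R (source x * indicator {- R..} x)))"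
      by (intro integrable_lborel_prod_mult integrable_mult_right integrable_indicator_Icc)
    show "case_prod J \<in> borel_measurable (lborel \<Otimes>\<^sub>M lborel)"
      unfolding J_def by measurable
    have "\<bar>J t x\<bar> \<le> \<bar>(C * indicator {0..R} t) * (indicator {..R} x *\<^sub>R (source x * indicator {- R..} x))\<bar>" for t x
    proof -
      have "\<bar>J t x\<bar> \<le> \<bar>source x\<bar> * (1 * (C * (indicator {0..R} t * indicator {0..R} (t + x))))"
        unfolding J_def abs_mult[of "source x"] abs_mult[of "decay t x"]
        by (intro mult_left_mono mult_mono decay_bound L_bound) auto
      also have "\<dots> \<le> \<bar>(C * indicator {0..R} t) * (indicator {..R} x *\<^sub>R (source x * indicator {- R..} x))\<bar>"
        using C by (auto simp: abs_mult split: split_indicator)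
      finally show ?thesis .
    qed
    then show "AE p in lborel \<Otimes>\<^sub>M lborel. norm (case_prod J p)
        \<le> norm (case p of (t, x) \<Rightarrow> (C * indicator {0..R} t) * (indicator {..R} x *\<^sub>R (source x * indicator {- R..} x)))"
      by (intro AE_I2) (auto simp: case_prod_unfold)
  qed
  have J_t: "(LINT t|lborel. J t x) = - (source x * \<phi> (max 0 (- x)) (max 0 (- x) + x))" for x
  proof -
    define t0 where "t0 = max 0 (- x)"
    \<comment> \<open>Strictly beyond \<open>R\<close>, where \<open>\<phi>\<close> vanishes, and
      not before the entry time \<open>t0\<close>.\<close>
    define S where "S = max R t0 + 1"
    have t0S: "t0 \<le> S" "0 \<le> t0" "0 \<le> t0 + x" by (auto simp: S_def t0_def)
    have path: "continuous_on {t0..S} (\<lambda>t. (t, t + x))" "(\<lambda>t. (t, t + x)) ` {t0..S} \<subseteq> {0..} \<times> {0..}"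
      using t0S by (auto intro!: continuous_intros)
    have contK: "continuous_on {t0..S} (\<lambda>t. decay t x * \<phi> t (t + x))"
      using continuous_on_compose2[OF c path] by (auto intro!: continuous_intros decay_continuous)
    have derivK: "((\<lambda>t. decay t x * \<phi> t (t + x)) has_vector_derivative decay t x * L t (t + x)) (at t)"
      if t: "t \<in> {t0<..<S} - {\<tau> - x}" for t
    proof -
      have "((\<lambda>t. decay t x * \<phi> t (t + x)) has_real_derivative
          (- (\<mu> + a t * indicator {\<tau>..} (t + x)) * decay t x) * \<phi> t (t + x)
          + (\<phi>\<^sub>t t (t + x) + \<phi>\<^sub>s t (t + x)) * decay t x) (at t)"
        using t by (intro DERIV_mult decay_derivative test_function_characteristic_derivative[OF tf]) (auto simp: t0_def)
      also have "(- (\<mu> + a t * indicator {\<tau>..} (t + x)) * decay t x) * \<phi> t (t + x)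
          + (\<phi>\<^sub>t t (t + x) + \<phi>\<^sub>s t (t + x)) * decay t x = decay t x * L t (t + x)"
        using t t0S by (subst L_eq) (auto simp: D_def algebra_simps)
      finally show ?thesis by (simp add: has_real_derivative_iff_has_vector_derivative)
    qed
    have "((\<lambda>t. decay t x * L t (t + x)) has_integral
        decay S x * \<phi> S (S + x) - decay t0 x * \<phi> t0 (t0 + x)) {t0..S}"
      \<comment> \<open>The time \<open>\<tau> - x\<close> is the exceptional point without a
        derivative; continuity of the product is enough there.\<close>
      by (rule fundamental_theorem_of_calculus_interior_strong[where S="{\<tau> - x}", OF _ t0S(1) derivK contK]) simp
    moreover have "\<phi> S (S + x) = 0"
    proof -
      have "S > R" by (simp add: S_def)
      then show ?thesis using R(2)[of S "S + x"] t0S by simp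
    qed
    moreover have "decay t0 x = 1" unfolding t0_def by (rule decay_start)
    ultimately have hk: "integral {t0..S} (\<lambda>t. decay t x * L t (t + x)) = - \<phi> t0 (t0 + x)"
      by (simp add: integral_unique)
    have int: "integrable lborel (\<lambda>t. decay t x * L t (t + x))"
    proof (rule Bochner_Integration.integrable_bound)
      show "integrable lborel (\<lambda>t. C * indicator {0..R} t :: real)"
        by (intro integrable_mult_right integrable_indicator_Icc)
      show "(\<lambda>t. decay t x * L t (t + x)) \<in> borel_measurable lborel" by measurable
      have "\<bar>decay t x * L t (t + x)\<bar> \<le> 1 * (C * indicator {0..R} t)" for t
        unfolding abs_mult
      proof (intro mult_mono decay_bound)
        show "\<bar>L t (t + x)\<bar> \<le> C * indicator {0..R} t"
          using L_bound[of t "t + x"] C by (auto split: split_indicator_asm)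
      qed auto
      then show "AE t in lborel. norm (decay t x * L t (t + x)) \<le> norm (C * indicator {0..R} t :: real)"
        using C by (auto simp: abs_mult)
    qed
    then have si: "set_integrable lborel {t0..S} (\<lambda>t. decay t x * L t (t + x))"
      unfolding set_integrable_def by (intro integrable_mult_indicator) auto
    have "(LINT t|lborel. decay t x * L t (t + x)) = (LINT t:{t0..S}|lborel. decay t x * L t (t + x))"
      unfolding set_lebesgue_integral_def
    proof (rule Bochner_Integration.integral_cong)
      fix t
      have "L t (t + x) = 0" if "t \<notin> {t0..S}"
        by (rule L_0) (use that in \<open>auto simp: t0_def S_def\<close>)
      then show "decay t x * L t (t + x) = indicator {t0..S} t *\<^sub>R (decay t x * L t (t + x))"
        by (cases "t \<in> {t0..S}") auto
    qed simp
    also have "\<dots> = - \<phi> t0 (t0 + x)"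
      using hk set_borel_integral_eq_integral(2)[OF si] by simp
    finally show ?thesis unfolding J_def t0_def by simp
  qed
  have 1: "(LINT t:{0..}|lborel. LINT s:{0..}|lborel. solution t s * D t s) = (LINT t|lborel. LINT x|lborel. J t x)"
    unfolding set_lebesgue_integral_def
  proof (rule Bochner_Integration.integral_cong)
    fix t
    have "indicator {0..} t *\<^sub>R (LINT s|lborel. indicator {0..} s *\<^sub>R (solution t s * D t s)) = (LINT s|lborel. J t (s + - t))"
    proof (cases "t \<ge> 0")
      case True
      have "indicator {0..} s *\<^sub>R (solution t s * D t s) = J t (s + - t)" for s
        using True L_eq[of t s] L_0[of t s] by (cases "s \<ge> 0") (auto simp: J_def solution_def)
      then show ?thesis using True by simp
    next
      case False
      then have "J t (s + - t) = 0" for s using L_0[of t] by (simp add: J_def)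
      then show ?thesis using False by simp
    qed
    also have "\<dots> = (LINT x|lborel. J t x)" by (rule lborel_integral_shift)
    finally show "indicator {0..} t *\<^sub>R (LINT s|lborel. indicator {0..} s *\<^sub>R (solution t s * D t s)) = (LINT x|lborel. J t x)" .
  qed simp
  also have "\<dots> = (LINT x|lborel. LINT t|lborel. J t x)"
    by (rule lborel_pair.Fubini_integral[OF J_int, symmetric])
  also have "\<dots> = (LINT x|lborel. - (source x * \<phi> (max 0 (- x)) (max 0 (- x) + x)))"
    unfolding J_t ..
  also have "\<dots> = (LINT x|lborel. - (indicator {0..} x *\<^sub>R (\<rho>\<^sub>0 x * \<phi> 0 x)) - indicator {..<0} x *\<^sub>R (b * \<phi> (- x) 0))"
    by (rule Bochner_Integration.integral_cong) (auto simp: source_def split: split_indicator)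
  also have "\<dots> = - (LINT s:{0..}|lborel. \<rho>\<^sub>0 s * \<phi> 0 s) - (LINT t:{0..}|lborel. b * \<phi> t 0)"
  proof -
    have "continuous_on {0..} (\<phi> 0)"
    proof -
      have p: "continuous_on {0..} (\<lambda>s::real. (0::real, s))" by (intro continuous_intros)
      have q: "(\<lambda>s::real. (0::real, s)) ` {0..} \<subseteq> {0..} \<times> {0..}" by auto
      show ?thesis using continuous_on_compose2[OF c p q] by simp
    qed
    then have "(\<lambda>s. indicator {0..} s *\<^sub>R \<phi> 0 s) \<in> borel_measurable borel"
      by (intro borel_measurable_continuous_on_indicator) auto
    then have "set_integrable lborel {0..} (\<lambda>s. \<rho>\<^sub>0 s * (indicator {0..} s *\<^sub>R \<phi> 0 s))"
      using B by (intro set_integrable_mult_bounded[OF \<rho>0, where K=B]) (auto split: split_indicator)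
    then have i1: "integrable lborel (\<lambda>s. indicator {0..} s *\<^sub>R (\<rho>\<^sub>0 s * \<phi> 0 s))"
      unfolding set_integrable_def by (rule Bochner_Integration.integrable_cong[THEN iffD1, rotated 2]) (auto split: split_indicator)
    have "continuous_on {0..} (\<lambda>t. \<phi> t 0)"
    proof -
      have p: "continuous_on {0..} (\<lambda>t::real. (t, 0::real))" by (intro continuous_intros)
      have q: "(\<lambda>t::real. (t, 0::real)) ` {0..} \<subseteq> {0..} \<times> {0..}" by auto
      show ?thesis using continuous_on_compose2[OF c p q] by simp
    qed
    then have "set_integrable lborel {0..R} (\<lambda>t. b * \<phi> t 0)"
      by (intro set_integrable_continuous_Icc continuous_intros) auto
    then have i2: "set_integrable lborel {0..} (\<lambda>t. b * \<phi> t 0)"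
      unfolding set_integrable_def
      by (rule Bochner_Integration.integrable_cong[THEN iffD1, rotated 2]) (use R(2) in \<open>auto simp: not_le split: split_indicator\<close>)
    then have i3: "integrable lborel (\<lambda>t. indicator {0<..} t *\<^sub>R (b * \<phi> t 0))"
      by (intro set_integrable_subset[OF i2, unfolded set_integrable_def]) auto
    \<comment> \<open>Reflection passes from the label \<open>x < 0\<close> to its entry time
      \<open>- x\<close>. The resulting half line is open at 0, which changes nothing up to a null
      set.\<close>
    have eq: "(\<lambda>x. indicator {..<0} x *\<^sub>R (b * \<phi> (- x) 0)) = (\<lambda>x. (\<lambda>t. indicator {0<..} t *\<^sub>R (b * \<phi> t 0)) (0 + (- 1) * x))"
      by (auto simp: fun_eq_iff split: split_indicator)
    have i4: "integrable lborel (\<lambda>x. indicator {..<0} x *\<^sub>R (b * \<phi> (- x) 0))"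
      unfolding eq by (rule lborel_integrable_real_affine[OF i3]) simp
    have "(LINT x|lborel. indicator {..<0} x *\<^sub>R (b * \<phi> (- x) 0)) = (LINT t|lborel. indicator {0<..} t *\<^sub>R (b * \<phi> t 0))"
      unfolding eq
      by (subst (2) lborel_integral_real_affine[of "- 1" _ 0]) simp_all
    also have "\<dots> = (LINT t:{0..}|lborel. b * \<phi> t 0)"
      unfolding set_lebesgue_integral_def
    proof (rule integral_cong_AE)
      show "AE t in lborel. indicator {0<..} t *\<^sub>R (b * \<phi> t 0) = indicator {0..} t *\<^sub>R (b * \<phi> t 0)"
        using AE_lborel_neq[of 0] by eventually_elim (auto split: split_indicator)
    qed (use i2 i3 in \<open>auto simp: set_integrable_def\<close>)
    finally have "(LINT x|lborel. indicator {..<0} x *\<^sub>R (b * \<phi> (- x) 0)) = (LINT t:{0..}|lborel. b * \<phi> t 0)" .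
    then show ?thesis
      using Bochner_Integration.integral_diff[OF Bochner_Integration.integrable_minus[OF i1] i4]
      unfolding set_lebesgue_integral_def by (simp only: Bochner_Integration.integral_minus)
  qed
  finally show "(LINT t:{0..}|lborel. LINT s:{0..}|lborel.
        solution t s * (\<phi>\<^sub>t t s + \<phi>\<^sub>s t s - \<mu> * \<phi> t s - a t * indicator {\<tau>..} s * \<phi> t s))
      + (LINT s:{0..}|lborel. \<rho>\<^sub>0 s * \<phi> 0 s) + (LINT t:{0..}|lborel. b * \<phi> t 0) = 0"
    unfolding D_def by simp
qed

end

section \<open>Well-posedness\<close>

text \<open>Makes the prescribed rate continuous. The moving end point \<open>\<tau> - r\<close>
  affects only one seniority in the limit.\<close>

lemma young_mass_continuous:
  assumes \<rho>0: "set_integrable lborel {0..} \<rho>\<^sub>0" and "\<mu> \<noteq> 0"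
  shows "continuous_on UNIV (young_mass \<mu> \<tau> b \<rho>\<^sub>0)"
proof -
  have "continuous_on UNIV (\<lambda>r. LINT s:{0..}|lborel. \<rho>\<^sub>0 s * indicator {..\<tau> - r} s)"
  proof (rule continuous_on_sequentiallyI)
    fix u r assume u: "u \<longlonglongrightarrow> (r :: real)"
    show "(\<lambda>n. LINT s:{0..}|lborel. \<rho>\<^sub>0 s * indicator {..\<tau> - u n} s)
        \<longlonglongrightarrow> (LINT s:{0..}|lborel. \<rho>\<^sub>0 s * indicator {..\<tau> - r} s)"
    proof (rule set_integral_bounded_convergence[OF \<rho>0, where K=1])
      show "AE s in lborel. (\<lambda>n. indicator {..\<tau> - u n} s :: real) \<longlonglongrightarrow> indicator {..\<tau> - r} s"
        using AE_lborel_neq[of "\<tau> - r"]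
      proof eventually_elim
        case (elim s)
        then consider "r < \<tau> - s" | "r > \<tau> - s" by linarith
        then have "\<forall>\<^sub>F n in sequentially. indicator {..\<tau> - u n} s = (indicator {..\<tau> - r} s :: real)"
        proof cases
          case 1
          from order_tendstoD(2)[OF u 1] show ?thesis
            by eventually_elim (use 1 in auto)
        next
          case 2
          from order_tendstoD(1)[OF u 2] show ?thesis
            by eventually_elim (use 2 in auto)
        qed
        then show ?case by (rule tendsto_eventually)
      qed
    qed (auto simp: indicator_def)
  qed
  then show ?thesis
    unfolding young_mass_def[abs_def] using assms(2) by (intro continuous_intros) auto
qed

lemma well_posed_if_young_mass_less:
  assumes \<mu>: "\<mu> > 0" and \<tau>: "\<tau> \<ge> 0" and c: "c \<ge> 0" and b: "b = \<mu> * N + c"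
    and \<rho>0: "set_integrable lborel {0..} \<rho>\<^sub>0" and N: "(LINT s:{0..}|lborel. \<rho>\<^sub>0 s) = N"
    and young: "\<And>r. r \<in> {0..\<tau>} \<Longrightarrow> young_mass \<mu> \<tau> b \<rho>\<^sub>0 r < N"
  shows "well_posed \<mu> \<tau> c b \<rho>\<^sub>0"
proof -
  \<comment> \<open>Clamping time to [0, \<tau>] extends the predicted eligible mass to negative
    times, since the locale asks for a continuous nonnegative rate on the whole line.\<close>
  define A where "A = (\<lambda>t. N - young_mass \<mu> \<tau> b \<rho>\<^sub>0 (max 0 (min t \<tau>)))"
  define a where "a = (\<lambda>t. c / A t)"
  have A_pos: "A t > 0" for t
    using young[of "max 0 (min t \<tau>)"] \<tau> by (simp add: A_def)
  have A_eq: "A t = N - young_mass \<mu> \<tau> b \<rho>\<^sub>0 (min t \<tau>)" if "t \<ge> 0" for t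
    using that \<tau> by (simp add: A_def max_def)
  have "continuous_on UNIV A"
    unfolding A_def using \<mu>
    by (intro continuous_intros continuous_on_compose2[OF young_mass_continuous[OF \<rho>0]]) auto
  then have a_cont: "continuous_on UNIV a"
    unfolding a_def using A_pos by (intro continuous_intros) (auto simp: less_imp_neq[symmetric])
  then have "isCont a t" for t
    by (simp add: continuous_on_eq_continuous_at)
  then obtain H where "\<And>t. (H has_real_derivative a t) (at t)"
    using einterval_antiderivative[of "-\<infinity>" "\<infinity>" a] by (auto simp: has_real_derivative_iff_has_vector_derivative)
  then interpret linear_transport \<mu> \<tau> b \<rho>\<^sub>0 a H
    using \<mu> \<tau> \<rho>0 a_cont c A_pos by unfold_locales (auto simp: a_def less_imp_le)
  have a_cont0: "continuous_on {0..} a" using a_cont by (rule continuous_on_subset) simp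
  have ac: "a t * (N - young_mass \<mu> \<tau> b \<rho>\<^sub>0 (min t \<tau>)) = c" if "t \<ge> 0" for t
    using A_pos[of t] unfolding a_def A_eq[OF that, symmetric] by simp
  have mass: "eligible_mass \<tau> (solution t) = A t" if "t \<ge> 0" for t
    using linear_solution_eligible_mass[OF solution_weak a_cont0 \<rho>0 N b \<tau> \<mu> that ac] A_eq[OF that] by simp
  \<comment> \<open>The equation sees the rate only at nonnegative times, so both formulations agree
    on every curve whose eligible mass is \<open>A\<close>. Existence uses one direction, uniqueness
    the other.\<close>
  have transfer: "linear_weak_solution \<mu> \<tau> (\<lambda>t. c / eligible_mass \<tau> (\<rho> t)) b \<rho>\<^sub>0 \<rho> \<longleftrightarrow> linear_weak_solution \<mu> \<tau> a b \<rho>\<^sub>0 \<rho>"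
    if "\<And>t. t \<ge> 0 \<Longrightarrow> eligible_mass \<tau> (\<rho> t) = A t" for \<rho>
  proof -
    have "(LINT t:{0..}|lborel. LINT s:{0..}|lborel.
          \<rho> t s * (\<phi>\<^sub>t t s + \<phi>\<^sub>s t s - \<mu> * \<phi> t s - c / eligible_mass \<tau> (\<rho> t) * indicator {\<tau>..} s * \<phi> t s))
        = (LINT t:{0..}|lborel. LINT s:{0..}|lborel.
          \<rho> t s * (\<phi>\<^sub>t t s + \<phi>\<^sub>s t s - \<mu> * \<phi> t s - a t * indicator {\<tau>..} s * \<phi> t s))" for \<phi> \<phi>\<^sub>t \<phi>\<^sub>s :: "real \<Rightarrow> real \<Rightarrow> real"
      by (rule set_lebesgue_integral_cong) (auto simp: that a_def)
    then show ?thesis unfolding linear_weak_solution_def by simp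
  qed
  show ?thesis
    unfolding well_posed_def
  proof (intro exI[of _ solution] conjI allI impI)
    show "weak_solution \<mu> \<tau> c b \<rho>\<^sub>0 solution"
      unfolding weak_solution_iff_linear using transfer[OF mass] solution_weak mass A_pos by simp
    fix \<rho>' t assume sol: "weak_solution \<mu> \<tau> c b \<rho>\<^sub>0 \<rho>'" and t: "0 \<le> (t :: real)"
    have "eligible_mass \<tau> (\<rho>' t) = A t" if "t \<ge> 0" for t
      using weak_solution_eligible_mass[OF sol \<rho>0 N b \<tau> \<mu> that] A_eq[OF that] by simp
    then have "linear_weak_solution \<mu> \<tau> a b \<rho>\<^sub>0 \<rho>'"
      using transfer[of \<rho>'] sol unfolding weak_solution_iff_linear by simp
    then show "AE s in lborel. 0 \<le> s \<longrightarrow> \<rho>' t s = solution t s"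
      by (rule linear_weak_solution_unique[OF solution_weak _ a_cont0 \<rho>0 \<tau> t])
  qed
qed

text \<open>Translating by \<open>r\<close> turns the mass formula into the expression in the
  assumption on the initial data, which thereby reads \<open>young_mass < N\<close>.\<close>

lemma young_mass_eq_shifted:
  assumes "r \<in> {0..\<tau>}"
  shows "young_mass \<mu> \<tau> b \<rho>\<^sub>0 r =
    exp (- r * \<mu>) * (LINT s:{r..\<tau>}|lborel. \<rho>\<^sub>0 (s - r)) + 1 / \<mu> * (1 - exp (- \<mu> * r)) * b"
proof -
  have "(LINT s:{r..\<tau>}|lborel. \<rho>\<^sub>0 (s - r)) =
      (LINT s|lborel. (\<lambda>x. indicator {0..} x *\<^sub>R (\<rho>\<^sub>0 x * indicator {..\<tau> - r} x)) (s + - r))"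
    unfolding set_lebesgue_integral_def
    by (rule Bochner_Integration.integral_cong) (auto split: split_indicator)
  also have "\<dots> = (LINT s:{0..}|lborel. \<rho>\<^sub>0 s * indicator {..\<tau> - r} s)"
    unfolding set_lebesgue_integral_def by (rule lborel_integral_shift)
  finally show ?thesis by (simp add: young_mass_def mult.commute)
qed

theorem proposition2p1:
  fixes L :: nat and N \<mu> \<tau> :: "nat \<Rightarrow> real" and \<rho>\<^sub>0 :: "nat \<Rightarrow> real \<Rightarrow> real"
  assumes "L \<ge> 2"
    and "\<And>j. j \<in> {1..L} \<Longrightarrow> N j > 0"
    and "\<And>j. j \<in> {1..L} \<Longrightarrow> \<mu> j > 0"
    and "\<And>j. j \<in> {1..L} \<Longrightarrow> \<tau> j \<ge> 0"
    and "\<And>j. j \<in> {1..L - 1} \<Longrightarrow> set_integrable lborel {0..} (\<rho>\<^sub>0 j)"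
    and "\<And>j. j \<in> {1..L - 1} \<Longrightarrow> AE s in lborel. s \<ge> 0 \<longrightarrow> \<rho>\<^sub>0 j s > 0"
    and "\<And>j. j \<in> {1..L - 1} \<Longrightarrow> (LINT s:{0..}|lborel. \<rho>\<^sub>0 j s) = N j"
    and "\<And>j t. j \<in> {1..L - 1} \<Longrightarrow> t \<in> {0..\<tau> j} \<Longrightarrow>
      exp (- t * \<mu> j) * (LINT s:{t..\<tau> j}|lborel. \<rho>\<^sub>0 j (s - t))
        + 1 / \<mu> j * (1 - exp (- \<mu> j * t)) * (\<Sum>l=j..L. \<mu> l * N l) < N j"
    and "\<And>j. j \<in> {1..L - 1} \<Longrightarrow> A_bar L N \<mu> \<tau> j > 0"
  shows "\<forall>j\<in>{1..L - 1}.
    well_posed (\<mu> j) (\<tau> j) (C_no L \<mu> N (j + 1)) (\<Sum>l=j..L. \<mu> l * N l) (\<rho>\<^sub>0 j) \<and>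
    (\<forall>\<rho>. weak_solution (\<mu> j) (\<tau> j) (C_no L \<mu> N (j + 1)) (\<Sum>l=j..L. \<mu> l * N l) (\<rho>\<^sub>0 j) \<rho> \<longrightarrow>
      (\<forall>t\<ge>0. eligible_mass (\<tau> j) (\<rho> t) > 0) \<and>
      (\<forall>t\<ge>\<tau> j. eligible_mass (\<tau> j) (\<rho> t) = A_bar L N \<mu> \<tau> j))"
proof (intro ballI conjI allI impI)
  \<comment> \<open>The levels interact only through constants built from the parameters, so each
    \<open>j\<close> is treated on its own.\<close>
  fix j assume j: "j \<in> {1..L - 1}"
  then have jL: "j \<in> {1..L}" "j \<le> L" by auto
  define c where "c = C_no L \<mu> N (j + 1)"
  define b where "b = (\<Sum>l=j..L. \<mu> l * N l)"
  have \<mu>: "\<mu> j > 0" and \<tau>: "\<tau> j \<ge> 0" using assms(3,4) jL by auto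
  have b: "b = \<mu> j * N j + c"
    unfolding b_def c_def C_no_def using jL(2) by (simp add: sum.atLeast_Suc_atMost)
  have c: "c \<ge> 0"
    unfolding c_def C_no_def using assms(2,3) j by (intro sum_nonneg mult_nonneg_nonneg) (auto intro!: less_imp_le)
  have young: "young_mass (\<mu> j) (\<tau> j) b (\<rho>\<^sub>0 j) r < N j" if "r \<in> {0..\<tau> j}" for r
    using assms(8)[OF j that] unfolding young_mass_eq_shifted[OF that] b_def .
  show "well_posed (\<mu> j) (\<tau> j) (C_no L \<mu> N (j + 1)) (\<Sum>l=j..L. \<mu> l * N l) (\<rho>\<^sub>0 j)"
    using well_posed_if_young_mass_less[OF \<mu> \<tau> c b assms(5)[OF j] assms(7)[OF j] young]
    unfolding b_def c_def .
  fix \<rho> assume "weak_solution (\<mu> j) (\<tau> j) (C_no L \<mu> N (j + 1)) (\<Sum>l=j..L. \<mu> l * N l) (\<rho>\<^sub>0 j) \<rho>"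
  then have sol: "weak_solution (\<mu> j) (\<tau> j) c b (\<rho>\<^sub>0 j) \<rho>"
    unfolding b_def c_def .
  show "eligible_mass (\<tau> j) (\<rho> t) > 0" if "t \<ge> 0" for t
    using sol that unfolding weak_solution_def by blast
  show "eligible_mass (\<tau> j) (\<rho> t) = A_bar L N \<mu> \<tau> j" if t: "t \<ge> \<tau> j" for t
  proof -
    have "eligible_mass (\<tau> j) (\<rho> t) = N j - young_mass (\<mu> j) (\<tau> j) b (\<rho>\<^sub>0 j) (\<tau> j)"
      using weak_solution_eligible_mass[OF sol assms(5)[OF j] assms(7)[OF j] b \<tau> \<mu>, of t] t \<tau>
      by (simp add: min_absorb2)
    \<comment> \<open>At time \<open>\<tau> j\<close> the initial workers occupy only seniorities
      from \<open>\<tau> j\<close> on; the mass below comes from the inflow alone.\<close>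
    also have "young_mass (\<mu> j) (\<tau> j) b (\<rho>\<^sub>0 j) (\<tau> j) = b * (1 - exp (- \<mu> j * \<tau> j)) / \<mu> j"
      by (simp add: young_mass_def set_integral_atLeast_atMost_nonpos)
    also have "N j - \<dots> = A_bar L N \<mu> \<tau> j"
      using \<mu> unfolding A_bar_def c_def[symmetric] b by (simp add: field_simps)
    finally show ?thesis .
  qed
qed

end
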